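(* Let $d\geq 1$ and let $\mathscr{F}\subseteq[0,1]^d$ be a non-empty closed set having every portion of positive cone width. Let $\mathscr{A}\subseteq(0,1)^d$ be an analytic set such that $\mathscr{A}\cap\mathscr{F}$ is relatively residual in $\mathscr{F}$. Then there exist a $1$-Lipschitz curve $\gamma\colon[0,1]\to(0,1)^d$ and sets $E\subseteq F\subseteq[0,1]$ such that: (i) $F$ is non-empty, closed and has every portion of positive measure; (ii) $E$ is residual in $F$; (iii) $\gamma$ is differentiable at every $t\in E$ with $\|\gamma'(t)\|=1$; (iv) for every $t\in E$, $\lim_{\delta\to 0}\operatorname{osc}(\gamma',[t-\delta,t+\delta])=0$; (v) $\gamma(E)\subseteq\mathscr{A}$.
   Context: A curve (Lipschitz curve) is a Lipschitz map $\gamma\colon I\to\mathbb{R}^d$, $I$ a closed interval, whose derivative is bounded away from zero in norm almost everywhere; "$1$-Lipschitz" means Lipschitz constant at most $1$. A set $\mathscr{F}\subseteq\mathbb{R}^d$ has every portion of positive cone width if for every open $U\subseteq\mathbb{R}^d$ with $U\cap\mathscr{F}\neq\emptyset$ there is a $C^1$-smooth curve $\nu_U\colon[0,1]\to\mathbb{R}^d$ with nowhere zero derivative such that $\nu_U^{-1}(U\cap\mathscr{F})$ has positive Lebesgue measure. A set $F\subseteq\mathbb{R}$ has every portion of positive measure if for every open $U\subseteq\mathbb{R}$ with $U\cap F\neq\emptyset$, $U\cap F$ has positive Lebesgue measure. For an $L^\infty$ map $\phi\colon I\to\mathbb{R}^d$ and $U\subseteq I$, $\operatorname{osc}(\phi,U)=\operatorname{ess\,sup}\{\|\phi(s)-\phi(t)\|\colon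 s,t\in U\}$. *)

theory Defs
  imports "HOL-Analysis.Analysis"
begin

definition every_portion_pos_cone_width :: "'a::euclidean_space set \<Rightarrow> bool" where
  "every_portion_pos_cone_width S \<longleftrightarrow>
     (\<forall>U. open U \<and> U \<inter> S \<noteq> {} \<longrightarrow>
        (\<exists>(\<nu>::real \<Rightarrow> 'a) \<nu>'.
            (\<forall>t\<in>{0..1}. (\<nu> has_vector_derivative \<nu>' t) (at t within {0..1}))
          \<and> continuous_on {0..1} \<nu>'
          \<and> (\<forall>t\<in>{0..1}. \<nu>' t \<noteq> 0)
          \<and> emeasure lebesgue {t\<in>{0..1}. \<nu> t \<in> U \<inter> S} > 0))"

definition every_portion_pos_measure :: "real set \<Rightarrow> bool" where
  "every_portion_pos_measure F \<longleftrightarrow>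
     (\<forall>U. open U \<and> U \<inter> F \<noteq> {} \<longrightarrow> emeasure lebesgue (U \<inter> F) > 0)"

definition nowhere_dense_in :: "'a::topological_space set \<Rightarrow> 'a set \<Rightarrow> bool" where
  "nowhere_dense_in S N \<longleftrightarrow>
     N \<subseteq> S \<and> (top_of_set S) interior_of ((top_of_set S) closure_of N) = {}"

definition meager_in :: "'a::topological_space set \<Rightarrow> 'a set \<Rightarrow> bool" where
  "meager_in S M \<longleftrightarrow> M \<subseteq> S \<and>
     (\<exists>\<N>. countable \<N> \<and> (\<forall>N\<in>\<N>. nowhere_dense_in S N) \<and> M \<subseteq> \<Union>\<N>)"

definition residual_in :: "'a::topological_space set \<Rightarrow> 'a set \<Rightarrow> bool" where
  "residual_in S E \<longleftrightarrow> E \<subseteq> S \<and> meager_in S (S - E)"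

text \<open>Analytic sets: empty, or a continuous image of the Baire space nat^nat
  (with the product topology of discrete nat).\<close>
definition analytic_set :: "'a::topological_space set \<Rightarrow> bool" where
  "analytic_set A \<longleftrightarrow> A = {} \<or>
     (\<exists>f :: (nat \<Rightarrow> nat) \<Rightarrow> 'a. continuous_on UNIV f \<and> range f = A)"

definition osc :: "(real \<Rightarrow> 'a::real_normed_vector) \<Rightarrow> real set \<Rightarrow> ereal" where
  "osc \<phi> U = Inf {c. AE p in (lebesgue_on U \<Otimes>\<^sub>M lebesgue_on U).
                      ereal (norm (\<phi> (fst p) - \<phi> (snd p))) \<le> c}"

definition lipschitz_curve :: "real \<Rightarrow> real \<Rightarrow> (real \<Rightarrow> 'a::euclidean_space) \<Rightarrow> bool" where
  "lipschitz_curve a b \<gamma> \<longleftrightarrow> a \<le> b \<and> (\<exists>L. L-lipschitz_on {a..b} \<gamma>) \<and>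
     (\<exists>c>0. AE t in lebesgue_on {a..b}.
        \<exists>v. (\<gamma> has_vector_derivative v) (at t within {a..b}) \<and> norm v \<ge> c)"

end

theory Submission
  imports Defs
begin

text \<open>
  By Baire's theorem the residual set contains \<open>\<F> \<inter> \<Inter>n. G n\<close> for a decreasing sequence of open sets that meet
  \<open>\<F>\<close> densely and lie in the open unit cube. Covering the unit sphere by finitely many small balls shows that
  every portion of \<open>\<F>\<close> has a subportion with a stable direction: a direction \<open>v\<close> such that each still smaller
  portion is met, in positive measure, by an arc pointing almost along \<open>v\<close>. These directions can be refined with
  an error tending to zero.

  The curve is a limit of modifications of a slow line. At each step one picks a time \<open>x\<close> that an earlier arc
  spends in \<open>\<F>\<close>, and in a tiny interval around \<open>x\<close> grafts a much shorter arc that meets \<open>\<F>\<close> inside the next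
  \<open>G n\<close>; affine corrections reconnect it to the old curve. All arcs have speed slightly below 1, which leaves
  room for the corrections, and the velocities inside a grafted arc stay within a small ball forever, so that a
  time lying in infinitely many arcs has a derivative of norm 1. The intervals are so short that every earlier
  set of times keeps positive measure, and \<open>F\<close> is the measure support of what remains. The points of \<open>F\<close> lying
  in infinitely many grafted arcs form \<open>E\<close>.
\<close>

subsection \<open>Lebesgue measure\<close>

definition lebesgue_support :: "'a::euclidean_space set \<Rightarrow> 'a set" where
  "lebesgue_support T = {t. \<forall>U. open U \<and> t \<in> U \<longrightarrow> 0 < emeasure lebesgue (U \<inter> T)}"

lemma closed_lebesgue_support: "closed (lebesgue_support T)"
proof -
  have "- lebesgue_support T = \<Union>{U. open U \<and> emeasure lebesgue (U \<inter> T) = 0}"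
    by (auto simp: lebesgue_support_def)
  then show ?thesis
    by (metis (mono_tags, lifting) closed_def mem_Collect_eq open_Union)
qed

lemma lebesgue_support_subset_closure: "lebesgue_support T \<subseteq> closure T"
proof
  fix t assume "t \<in> lebesgue_support T"
  then have "0 < emeasure lebesgue (- closure T \<inter> T)" if "t \<notin> closure T"
    using that by (simp add: lebesgue_support_def open_Compl)
  moreover have "- closure T \<inter> T = {}"
    using closure_subset by blast
  ultimately show "t \<in> closure T"
    by auto
qed

lemma null_diff_lebesgue_support:
  assumes T: "T \<in> sets lebesgue"
  shows "T - lebesgue_support T \<in> null_sets lebesgue"
proof -
  define \<U> where "\<U> = {U. open U \<and> emeasure lebesgue (U \<inter> T) = 0}"
  obtain \<V> where \<V>: "\<V> \<subseteq> \<U>" "countable \<V>" "\<Union>\<V> = \<Union>\<U>"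
    using Lindelof[of \<U>] by (auto simp: \<U>_def)
  have "T - lebesgue_support T = (\<Union>U\<in>\<V>. U \<inter> T)"
    using \<V>(3) by (auto simp: lebesgue_support_def \<U>_def)
  moreover have "(\<Union>U\<in>\<V>. U \<inter> T) \<in> null_sets lebesgue"
  proof (rule null_sets_UN')
    fix U assume "U \<in> \<V>"
    then have "open U" "emeasure lebesgue (U \<inter> T) = 0"
      using \<V>(1) by (auto simp: \<U>_def)
    moreover from \<open>open U\<close> have "U \<in> sets lebesgue"
      by (simp add: borel_open)
    ultimately show "U \<inter> T \<in> null_sets lebesgue"
      using T by (metis null_setsI sets.Int)
  qed (rule \<V>(2))
  ultimately show ?thesis by simp
qed

lemma emeasure_Int_lebesgue_support:
  assumes "A \<in> sets lebesgue" "T \<in> sets lebesgue" "A \<subseteq> T"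
  shows "emeasure lebesgue (A \<inter> lebesgue_support T) = emeasure lebesgue A"
proof -
  have "A \<inter> lebesgue_support T = A - (T - lebesgue_support T)"
    using assms(3) by blast
  then show ?thesis
    using emeasure_Diff_null_set[OF null_diff_lebesgue_support assms(1)] assms(2) by simp
qed

lemma lebesgue_support_meets:
  assumes "0 < emeasure lebesgue A" "T \<in> sets lebesgue" "A \<subseteq> T"
  shows "A \<inter> lebesgue_support T \<noteq> {}"
  using assms emeasure_Int_lebesgue_support[of A T] emeasure_notin_sets[of A lebesgue] by fastforce

lemma every_portion_pos_measure_lebesgue_support:
  assumes T: "T \<in> sets lebesgue"
  shows "every_portion_pos_measure (lebesgue_support T)"
  unfolding every_portion_pos_measure_def
proof (intro allI impI, elim conjE)
  fix U :: "real set" assume U: "open U" "U \<inter> lebesgue_support T \<noteq> {}"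
  then have "0 < emeasure lebesgue (U \<inter> T)"
    by (auto simp: lebesgue_support_def)
  also have "\<dots> = emeasure lebesgue (U \<inter> T \<inter> lebesgue_support T)"
    using T U by (intro emeasure_Int_lebesgue_support[symmetric]) (auto simp: borel_open)
  also have "\<dots> \<le> emeasure lebesgue (U \<inter> lebesgue_support T)"
    using U closed_lebesgue_support[of T] by (intro emeasure_mono) (auto simp: borel_open)
  finally show "0 < emeasure lebesgue (U \<inter> lebesgue_support T)" .
qed

lemma measure_compact_pos_iff:
  fixes K :: "'a::euclidean_space set"
  shows "compact K \<Longrightarrow> 0 < measure lebesgue K \<longleftrightarrow> 0 < emeasure lebesgue K"
  by (metis emeasure_eq_measure2 ennreal_less_zero_iff fmeasurableD2 lmeasurable_compact)

lemma exists_compact_subset_pos_measure: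
  fixes T :: "'a::euclidean_space set"
  assumes pos: "0 < emeasure lebesgue T" and bdd: "bounded T"
  obtains K where "compact K" "K \<subseteq> T" "0 < measure lebesgue K"
proof -
  have T: "T \<in> sets lebesgue"
    using pos emeasure_notin_sets by fastforce
  define e where "e = measure lebesgue T / 2"
  have "emeasure lebesgue T = ennreal (2 * e)"
    using T bdd by (simp add: e_def emeasure_eq_measure2 bounded_set_imp_lmeasurable)
  then have e: "0 < e" "ennreal e < emeasure lebesgue T"
    using pos by (auto simp: ennreal_less_zero_iff ennreal_less_iff)
  obtain K where K: "closed K" "K \<subseteq> T" "T - K \<in> lmeasurable" "emeasure lebesgue (T - K) < ennreal e"
    using sets_lebesgue_inner_closed[OF T e(1)] by blast
  then have "compact K"
    using bdd by (meson bounded_subset compact_eq_bounded_closed)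
  have "emeasure lebesgue T = emeasure lebesgue K + emeasure lebesgue (T - K)"
    using K by (metis Diff_partition Diff_disjoint plus_emeasure fmeasurableD \<open>compact K\<close> lmeasurable_compact)
  then have "emeasure lebesgue K \<noteq> 0"
    using K(4) e(2) by auto
  then show thesis
    using that K \<open>compact K\<close> by (metis measure_compact_pos_iff not_gr_zero)
qed

lemma emeasure_Diff_UN_pos:
  fixes A :: "nat \<Rightarrow> 'a set"
  assumes C: "C \<in> fmeasurable M" "0 < measure M C"
    and A: "\<And>j. j \<in> J \<Longrightarrow> A j \<in> fmeasurable M"
    and small: "\<And>j. j \<in> J \<Longrightarrow> measure M (A j) * 2 ^ (j + 2) \<le> measure M C"
  shows "0 < emeasure M (C - (\<Union>j\<in>J. A j))"
proof (rule ccontr)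
  assume null: "\<not> 0 < emeasure M (C - (\<Union>j\<in>J. A j))"
  let ?m = "measure M C"
  define D where "D j = (if j \<in> J then A j else {})" for j
  have UN_D: "(\<Union>j. D j) = (\<Union>j\<in>J. A j)"
    by (auto simp: D_def)
  have D_sets: "D j \<in> sets M" "emeasure M (D j) < \<infinity>" for j
    using A by (auto simp: D_def fmeasurable_def)
  have D_le: "measure M (D j) \<le> ?m / 2 * (1 / 2) ^ Suc j" for j
    using small[of j] C(2) by (auto simp: D_def field_simps)
  have geometric: "(\<lambda>j. ?m / 2 * (1 / 2) ^ Suc j) sums (?m / 2)"
    using sums_mult[OF power_half_series, of "?m / 2"] by simp
  have summable: "summable (\<lambda>j. measure M (D j))"
    by (rule summable_comparison_test'[OF sums_summable[OF geometric]]) (use D_le in simp)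
  have "ennreal ?m = emeasure M C"
    using C(1) by (simp add: emeasure_eq_measure2)
  also have "\<dots> \<le> emeasure M ((C - (\<Union>j. D j)) \<union> (\<Union>j. D j))"
    using D_sets C(1) by (intro emeasure_mono) auto
  also have "\<dots> \<le> emeasure M (C - (\<Union>j. D j)) + emeasure M (\<Union>j. D j)"
    using D_sets C(1) by (intro emeasure_subadditive) auto
  also have "\<dots> \<le> ennreal (\<Sum>j. measure M (D j))"
    using emeasure_union_summable[OF D_sets summable] null by (simp add: UN_D)
  also have "\<dots> \<le> ennreal (?m / 2)"
    using suminf_le[OF D_le summable sums_summable[OF geometric]] sums_unique[OF geometric]
    by (intro ennreal_leI) simp
  finally show False
    using C(2) by (simp add: ennreal_le_iff2)
qed

subsection \<open>Residual sets\<close>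

lemma nowhere_dense_in_iff:
  "nowhere_dense_in S N \<longleftrightarrow> N \<subseteq> S \<and> S \<subseteq> closure (S - closure N)"
proof -
  have "(top_of_set S) interior_of ((top_of_set S) closure_of N) = {} \<longleftrightarrow> S \<subseteq> closure (S - closure N)"
    if "N \<subseteq> S"
  proof -
    have "(top_of_set S) interior_of ((top_of_set S) closure_of N) = S - (top_of_set S) closure_of (S - closure N)"
      using that by (simp add: interior_of_closure_of closure_of_subtopology Diff_Int_distrib Int_absorb1)
    also have "\<dots> = S - closure (S - closure N)"
      by (auto simp: closure_of_subtopology Int_absorb1)
    finally show ?thesis
      by (simp add: Diff_eq_empty_iff)
  qed
  then show ?thesis
    by (auto simp: nowhere_dense_in_def)
qed

lemma residual_in_Int_INT_open:
  fixes U :: "nat \<Rightarrow> 'a::topological_space set"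
  assumes "\<And>n. open (U n)" "\<And>n. S \<subseteq> closure (S \<inter> U n)"
  shows "residual_in S (S \<inter> (\<Inter>n. U n))"
proof -
  have "nowhere_dense_in S (S - U n)" for n
  proof -
    have "S \<inter> U n \<subseteq> S - closure (S - U n)"
      using assms(1)[of n] open_Int_closure_eq_empty[of "U n" "S - U n"] by blast
    then have "S \<subseteq> closure (S - closure (S - U n))"
      using assms(2)[of n] closure_mono by (metis order_trans)
    then show ?thesis
      by (simp add: nowhere_dense_in_iff)
  qed
  moreover have "S - S \<inter> (\<Inter>n. U n) \<subseteq> (\<Union>n. S - U n)"
    by blast
  ultimately show ?thesis
    unfolding residual_in_def meager_in_def by (intro conjI exI[of _ "range (\<lambda>n. S - U n)"]) auto
qed

lemma Baire_nowhere_dense_in: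
  fixes S :: "'a::{real_normed_vector,heine_borel} set"
  assumes "countable \<N>" "\<And>N. N \<in> \<N> \<Longrightarrow> nowhere_dense_in S N" "closed S"
  shows "S \<subseteq> closure (S - (\<Union>N\<in>\<N>. closure N))"
proof -
  have "S \<subseteq> closure (\<Inter>(insert S ((\<lambda>N. S - closure N) ` \<N>)))"
  proof (rule Baire[OF \<open>closed S\<close>])
    fix T assume "T \<in> insert S ((\<lambda>N. S - closure N) ` \<N>)"
    moreover have "openin (top_of_set S) (S - closure N)" for N
      unfolding Diff_eq by (intro openin_open_Int open_Compl closed_closure)
    ultimately show "openin (top_of_set S) T \<and> S \<subseteq> closure T"
      using assms(2) closure_subset[of S] by (auto simp: nowhere_dense_in_iff)
  qed (use assms(1) in simp)
  also have "\<Inter>(insert S ((\<lambda>N. S - closure N) ` \<N>)) = S - (\<Union>N\<in>\<N>. closure N)"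
    by blast
  finally show ?thesis .
qed

lemma residual_inE:
  fixes S :: "'a::{real_normed_vector,heine_borel} set"
  assumes res: "residual_in S (A \<inter> S)" and "closed S" "open W" and sub: "A \<subseteq> W"
  obtains G :: "nat \<Rightarrow> 'a set"
  where "\<And>n. open (G n)" "decseq G" "\<And>n. G n \<subseteq> W" "\<And>n. S \<subseteq> closure (S \<inter> G n)" "S \<inter> (\<Inter>n. G n) \<subseteq> A"
proof -
  obtain \<N> where \<N>: "countable \<N>" "\<And>N. N \<in> \<N> \<Longrightarrow> nowhere_dense_in S N" "S - A \<inter> S \<subseteq> \<Union>\<N>"
    using res unfolding residual_in_def meager_in_def by blast
  define D where "D = S - (\<Union>N\<in>\<N>. closure N)"
  define e where "e = from_nat_into (insert {} \<N>)"
  have range_e: "range e = insert {} \<N>"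
    unfolding e_def using \<N>(1) by (intro range_from_nat_into) auto
  define G where "G n = W - (\<Union>i\<le>n. closure (e i))" for n
  have "\<Union>\<N> \<subseteq> (\<Union>N\<in>\<N>. closure N)"
    using closure_subset by blast
  then have "D \<subseteq> A"
    using \<N>(3) unfolding D_def by blast
  have UN_e: "(\<Union>i. closure (e i)) = (\<Union>N\<in>\<N>. closure N)"
    unfolding image_image[symmetric, of closure e] range_e by simp
  then have "D \<inter> closure (e i) = {}" for i
    unfolding D_def by blast
  moreover have "D \<subseteq> S \<inter> W"
    using \<open>D \<subseteq> A\<close> sub unfolding D_def by blast
  ultimately have "D \<subseteq> S \<inter> G n" for n
    unfolding G_def by blast
  show thesis
  proof (rule that)
    show "open (G n)" for n
      unfolding G_def using \<open>open W\<close> by (intro open_Diff closed_UN) auto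
    show "decseq G"
      by (fastforce simp: decseq_def G_def)
    show "G n \<subseteq> W" for n
      by (auto simp: G_def)
    show "S \<subseteq> closure (S \<inter> G n)" for n
      using Baire_nowhere_dense_in[OF \<N>(1,2) \<open>closed S\<close>] closure_mono[OF \<open>D \<subseteq> S \<inter> G n\<close>]
      by (simp add: D_def)
    have "\<Inter>(range G) \<inter> (\<Union>i. closure (e i)) = {}"
      by (auto simp: G_def)
    then have "S \<inter> (\<Inter>n. G n) \<subseteq> D"
      unfolding D_def UN_e by blast
    then show "S \<inter> (\<Inter>n. G n) \<subseteq> A"
      using \<open>D \<subseteq> A\<close> by blast
  qed
qed

subsection \<open>Curves of nearly constant velocity\<close>

definition velocity_near :: "'a::real_normed_vector \<Rightarrow> real \<Rightarrow> (real \<Rightarrow> 'a) \<Rightarrow> real set \<Rightarrow> bool" where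
  "velocity_near w e g X \<longleftrightarrow> e-lipschitz_on X (\<lambda>t. g t - t *\<^sub>R w)"

lemma velocity_near_0: "velocity_near 0 e g X \<longleftrightarrow> e-lipschitz_on X g"
  by (simp add: velocity_near_def)

lemma velocity_near_iff:
  "velocity_near w e g X \<longleftrightarrow>
     0 \<le> e \<and> (\<forall>s\<in>X. \<forall>t\<in>X. norm (g s - g t - (s - t) *\<^sub>R w) \<le> e * \<bar>s - t\<bar>)"
  by (simp add: velocity_near_def lipschitz_on_def dist_norm scaleR_diff_left algebra_simps)

lemma velocity_nearD:
  "velocity_near w e g X \<Longrightarrow> s \<in> X \<Longrightarrow> t \<in> X \<Longrightarrow> norm (g s - g t - (s - t) *\<^sub>R w) \<le> e * \<bar>s - t\<bar>"
  by (simp add: velocity_near_iff)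

lemma velocity_near_mono:
  "velocity_near w e g X \<Longrightarrow> Y \<subseteq> X \<Longrightarrow> e \<le> e' \<Longrightarrow> velocity_near w e' g Y"
  unfolding velocity_near_def by (rule lipschitz_on_mono)

lemma velocity_near_cong:
  "(\<And>t. t \<in> X \<Longrightarrow> g t = h t) \<Longrightarrow> velocity_near w e g X \<longleftrightarrow> velocity_near w e h X"
  by (simp add: velocity_near_def)

lemma velocity_near_join:
  assumes "velocity_near w e g {a..b}" "velocity_near w e g {b..c}"
  shows "velocity_near w e g {a..c}"
  using lipschitz_on_concat[OF assms[unfolded velocity_near_def]] by (simp add: velocity_near_def)

lemma velocity_near_add:
  assumes "velocity_near w e g X" "velocity_near w' e' g' X"
  shows "velocity_near (w + w') (e + e') (\<lambda>t. g t + g' t) X"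
  using lipschitz_on_add[OF assms[unfolded velocity_near_def]]
  by (simp add: velocity_near_def scaleR_add_right algebra_simps)

lemma velocity_near_linear: "velocity_near w 0 (\<lambda>t. c + (t - b) *\<^sub>R w) X"
  by (simp add: velocity_near_iff algebra_simps)

lemma velocity_near_change:
  assumes "velocity_near w e g X"
  shows "velocity_near w' (e + norm (w - w')) g X"
proof -
  have "(norm (w - w'))-lipschitz_on X (\<lambda>t. t *\<^sub>R (w - w'))"
    by (rule lipschitz_onI) (auto simp: dist_norm mult.commute simp flip: scaleR_diff_left)
  from lipschitz_on_add[OF assms[unfolded velocity_near_def] this] show ?thesis
    by (simp add: velocity_near_def scaleR_diff_right)
qed

lemma velocity_near_imp_lipschitz:
  assumes "velocity_near w e g X"
  shows "(e + norm w)-lipschitz_on X g"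
  using velocity_near_change[OF assms, of 0] by (simp add: velocity_near_0)

lemma velocity_near_limit:
  assumes near: "\<And>n. N \<le> n \<Longrightarrow> velocity_near w e (g n) X"
    and lim: "\<And>t. t \<in> X \<Longrightarrow> (\<lambda>n. g n t) \<longlonglongrightarrow> h t"
  shows "velocity_near w e h X"
  unfolding velocity_near_iff
proof (intro conjI ballI)
  show "0 \<le> e"
    using near[of N] by (simp add: velocity_near_iff)
  fix s t assume st: "s \<in> X" "t \<in> X"
  have "(\<lambda>n. norm (g n s - g n t - (s - t) *\<^sub>R w)) \<longlonglongrightarrow> norm (h s - h t - (s - t) *\<^sub>R w)"
    using st by (intro tendsto_intros lim)
  then show "norm (h s - h t - (s - t) *\<^sub>R w) \<le> e * \<bar>s - t\<bar>"
    by (rule LIMSEQ_le_const2) (use near st in \<open>auto intro: velocity_nearD\<close>)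
qed

lemma velocity_near_affine:
  assumes "velocity_near w e g ((\<lambda>s. m *\<^sub>R s + c) ` X)"
  shows "velocity_near (m *\<^sub>R w) (\<bar>m\<bar> * e) (g \<circ> (\<lambda>s. m *\<^sub>R s + c)) X"
  unfolding velocity_near_iff
proof (intro conjI ballI)
  show "0 \<le> \<bar>m\<bar> * e"
    using assms by (simp add: velocity_near_iff)
  fix s t assume "s \<in> X" "t \<in> X"
  then have "norm (g (m *\<^sub>R s + c) - g (m *\<^sub>R t + c) - ((m *\<^sub>R s + c) - (m *\<^sub>R t + c)) *\<^sub>R w) \<le>
      e * \<bar>(m *\<^sub>R s + c) - (m *\<^sub>R t + c)\<bar>"
    by (intro velocity_nearD[OF assms]) auto
  also have "(m *\<^sub>R s + c) - (m *\<^sub>R t + c) = (s - t) * m"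
    by (simp add: algebra_simps)
  finally show "norm ((g \<circ> (\<lambda>s. m *\<^sub>R s + c)) s - (g \<circ> (\<lambda>s. m *\<^sub>R s + c)) t - (s - t) *\<^sub>R m *\<^sub>R w) \<le>
      \<bar>m\<bar> * e * \<bar>s - t\<bar>"
    by (simp add: abs_mult mult_ac)
qed

lemma velocity_near_of_has_vector_derivative:
  assumes der: "\<And>t. t \<in> X \<Longrightarrow> (g has_vector_derivative g' t) (at t within X)"
    and near: "\<And>t. t \<in> X \<Longrightarrow> norm (g' t - w) \<le> e" and "convex X" "0 \<le> e"
  shows "velocity_near w e g X"
  unfolding velocity_near_def
proof (rule bounded_derivative_imp_lipschitz)
  fix t assume t: "t \<in> X"
  show "((\<lambda>t. g t - t *\<^sub>R w) has_derivative (\<lambda>h. h *\<^sub>R (g' t - w))) (at t within X)"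
    using der[OF t] unfolding has_vector_derivative_def
    by (auto intro!: derivative_eq_intros simp: scaleR_diff_right)
  show "onorm (\<lambda>h. h *\<^sub>R (g' t - w)) \<le> e"
    using near[OF t] by (intro onorm_le) (simp add: mult_left_mono mult.commute[of e])
qed (use assms in auto)

definition locally_velocity_near :: "'a::real_normed_vector \<Rightarrow> real \<Rightarrow> (real \<Rightarrow> 'a) \<Rightarrow> real \<Rightarrow> bool" where
  "locally_velocity_near w e g t \<longleftrightarrow> (\<exists>d>0. velocity_near w e g (cball t d))"

lemma locally_velocity_nearI:
  assumes "velocity_near w e g {a..b}" "t \<in> {a<..<b}"
  shows "locally_velocity_near w e g t"
  unfolding locally_velocity_near_def
proof (intro exI conjI)
  show "0 < min (t - a) (b - t)"
    using assms(2) by simp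
  show "velocity_near w e g (cball t (min (t - a) (b - t)))"
    by (rule velocity_near_mono[OF assms(1)]) (auto simp: cball_eq_atLeastAtMost)
qed

lemma locally_velocity_near_weaken:
  assumes "locally_velocity_near w e g t" "e + norm (w - w') \<le> e'"
  shows "locally_velocity_near w' e' g t"
  using assms velocity_near_change velocity_near_mono unfolding locally_velocity_near_def by blast

lemma norm_slope_diff_le:
  fixes u w w' :: "'a::real_normed_vector"
  assumes "norm (u - h *\<^sub>R w) \<le> e * h" "norm (u - h *\<^sub>R w') \<le> e' * h" "0 < h"
  shows "norm (w - w') \<le> e + e'"
proof -
  have "h *\<^sub>R (w - w') = (u - h *\<^sub>R w') - (u - h *\<^sub>R w)"
    by (simp add: algebra_simps)
  then have "norm (h *\<^sub>R (w - w')) \<le> e' * h + e * h"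
    using assms(1,2) by (metis add_mono norm_triangle_ineq4 order_trans)
  also have "\<dots> = h * (e + e')"
    by (simp add: algebra_simps)
  finally show ?thesis
    using assms(3) by simp
qed

lemma locally_velocity_near_dist:
  assumes "locally_velocity_near w e g t" "locally_velocity_near w' e' g t"
  shows "norm (w - w') \<le> e + e'"
proof -
  obtain d d' where d: "0 < d" "velocity_near w e g (cball t d)"
    and d': "0 < d'" "velocity_near w' e' g (cball t d')"
    using assms by (auto simp: locally_velocity_near_def)
  define h where "h = min d d'"
  have h: "0 < h" "t + h \<in> cball t d \<inter> cball t d'"
    using d(1) d'(1) by (auto simp: h_def dist_real_def)
  show ?thesis
  proof (rule norm_slope_diff_le[OF _ _ h(1)])
    show "norm (g (t + h) - g t - h *\<^sub>R w) \<le> e * h"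
      using velocity_nearD[OF d(2), of "t + h" t] h d by auto
    show "norm (g (t + h) - g t - h *\<^sub>R w') \<le> e' * h"
      using velocity_nearD[OF d'(2), of "t + h" t] h d' by auto
  qed
qed

lemma has_vector_derivative_of_locally_velocity_near:
  assumes "\<And>e. 0 < e \<Longrightarrow> locally_velocity_near v e g t"
  shows "(g has_vector_derivative v) (at t)"
  unfolding has_vector_derivative_def has_derivative_at_alt
proof (intro conjI allI impI)
  fix e :: real assume "0 < e"
  then obtain d where "0 < d" "velocity_near v e g (cball t d)"
    using assms by (auto simp: locally_velocity_near_def)
  then have "norm (g y - g t - (y - t) *\<^sub>R v) \<le> e * norm (y - t)" if "norm (y - t) < d" for y
    using that by (auto intro!: velocity_nearD simp: dist_norm norm_minus_commute)
  with \<open>0 < d\<close> show "\<exists>d>0. \<forall>y. norm (y - t) < d \<longrightarrow> norm (g y - g t - (y - t) *\<^sub>R v) \<le> e * norm (y - t)"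
    by blast
qed (rule bounded_linear_scaleR_left)

lemma locally_velocity_near_vector_derivative:
  assumes near: "locally_velocity_near w e g t" and der: "(g has_vector_derivative v) (at t)"
  shows "norm (v - w) \<le> e"
proof (rule field_le_epsilon)
  fix \<epsilon> :: real assume "0 < \<epsilon>"
  then obtain d where d: "0 < d" "\<And>y. norm (y - t) < d \<Longrightarrow> norm (g y - g t - (y - t) *\<^sub>R v) \<le> \<epsilon> * norm (y - t)"
    using der unfolding has_vector_derivative_def has_derivative_at_alt by blast
  obtain d' where d': "0 < d'" "velocity_near w e g (cball t d')"
    using near by (auto simp: locally_velocity_near_def)
  define h where "h = min (d / 2) d'"
  have h: "0 < h" "h < d" "t + h \<in> cball t d'"
    using d(1) d'(1) by (auto simp: h_def dist_real_def)
  have "norm (v - w) \<le> \<epsilon> + e"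
  proof (rule norm_slope_diff_le[OF _ _ h(1)])
    show "norm (g (t + h) - g t - h *\<^sub>R v) \<le> \<epsilon> * h"
      using d(2)[of "t + h"] h by simp
    show "norm (g (t + h) - g t - h *\<^sub>R w) \<le> e * h"
      using velocity_nearD[OF d'(2), of "t + h" t] h d' by auto
  qed
  then show "norm (v - w) \<le> e + \<epsilon>"
    by simp
qed

lemma exists_vector_derivative_of_locally_velocity_near:
  fixes g :: "real \<Rightarrow> 'a::banach"
  assumes near: "\<And>e. 0 < e \<Longrightarrow> \<exists>w\<in>W. locally_velocity_near w e g t" and "closed W"
  shows "\<exists>v\<in>W. (g has_vector_derivative v) (at t)"
proof -
  have "\<forall>n. \<exists>w\<in>W. locally_velocity_near w ((1 / 2) ^ n) g t"
    using near by simp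
  then obtain w where w: "\<And>n. w n \<in> W" "\<And>n. locally_velocity_near (w n) ((1 / 2) ^ n) g t"
    by metis
  have zero: "(\<lambda>n. (1 / 2 :: real) ^ n) \<longlonglongrightarrow> 0"
    by (rule LIMSEQ_power_zero) simp
  have "Cauchy w"
  proof (rule metric_CauchyI)
    fix e :: real assume "0 < e"
    then obtain N where N: "\<And>n. N \<le> n \<Longrightarrow> (1 / 2) ^ n < e / 2"
      using order_tendstoD(2)[OF zero, of "e / 2"] by (auto simp: eventually_sequentially)
    have "dist (w m) (w n) < e" if "N \<le> m" "N \<le> n" for m n
      using locally_velocity_near_dist[OF w(2)[of m] w(2)[of n]] N[OF that(1)] N[OF that(2)]
      by (simp add: dist_norm)
    then show "\<exists>N. \<forall>m\<ge>N. \<forall>n\<ge>N. dist (w m) (w n) < e" by blast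
  qed
  then obtain v where v: "w \<longlonglongrightarrow> v"
    using Cauchy_convergent convergent_def by blast
  have "(g has_vector_derivative v) (at t)"
  proof (rule has_vector_derivative_of_locally_velocity_near)
    fix e :: real assume "0 < e"
    have "(\<lambda>n. (1 / 2) ^ n + norm (w n - v)) \<longlonglongrightarrow> 0 + 0"
      using tendsto_norm[OF LIM_zero[OF v]] zero by (intro tendsto_add) auto
    then have "\<forall>\<^sub>F n in sequentially. (1 / 2) ^ n + norm (w n - v) < e"
      by (rule order_tendstoD(2)) (use \<open>0 < e\<close> in simp)
    then obtain n where "(1 / 2) ^ n + norm (w n - v) < e"
      using eventually_happens'[OF sequentially_bot] by blast
    then show "locally_velocity_near v e g t"
      by (intro locally_velocity_near_weaken[OF w(2)[of n]]) simp
  qed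
  moreover have "v \<in> W"
    using closed_sequentially[OF \<open>closed W\<close> w(1) v] .
  ultimately show ?thesis by blast
qed

lemma has_vector_derivative_zero_of_quadratic:
  fixes g :: "real \<Rightarrow> 'a::real_normed_vector"
  assumes "\<And>s. norm (g s) \<le> C * (s - t)\<^sup>2"
  shows "(g has_vector_derivative 0) (at t within X)"
proof -
  have "g t = 0" using assms[of t] by simp
  have "((\<lambda>s. g s /\<^sub>R norm (s - t)) \<longlongrightarrow> 0) (at t within X)"
  proof (rule Lim_null_comparison)
    show "\<forall>\<^sub>F s in at t within X. norm (g s /\<^sub>R norm (s - t)) \<le> C * \<bar>s - t\<bar>"
      using assms by (intro always_eventually) (auto simp: divide_simps power2_eq_square mult.assoc)
    show "((\<lambda>s. C * \<bar>s - t\<bar>) \<longlongrightarrow> 0) (at t within X)"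
      by (auto intro!: tendsto_eq_intros)
  qed
  then show ?thesis
    by (simp add: has_vector_derivative_def has_derivative_at_within \<open>g t = 0\<close>)
qed

lemma piecewise_differentiable_join:
  fixes g :: "real \<Rightarrow> 'a::real_normed_vector"
  assumes "g piecewise_differentiable_on {a..b}" "g piecewise_differentiable_on {b..c}" "a \<le> b" "b \<le> c"
  shows "g piecewise_differentiable_on {a..c}"
  using piecewise_differentiable_cases[OF assms refl] by simp

lemma piecewise_differentiable_cong:
  assumes "\<And>t. t \<in> X \<Longrightarrow> g t = h t" "g piecewise_differentiable_on X"
  shows "h piecewise_differentiable_on X"
  using assms unfolding piecewise_differentiable_on_def
  by (metis (no_types, lifting) DiffD1 continuous_on_cong differentiable_transform_within zero_less_one)

subsection \<open>Oscillation of the derivative\<close>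

lemma osc_le:
  assumes U: "U \<in> lmeasurable" and ae: "AE s in lebesgue_on U. norm (\<phi> s - v) \<le> R"
  shows "osc \<phi> U \<le> ereal (2 * R)"
proof -
  let ?M = "lebesgue_on U"
  interpret finite_measure ?M
    using U by (rule finite_measure_lebesgue_on)
  interpret pair_sigma_finite ?M ?M ..
  obtain N where N: "{s \<in> space ?M. \<not> norm (\<phi> s - v) \<le> R} \<subseteq> N" "N \<in> null_sets ?M"
    using ae by (auto elim!: AE_E simp: null_sets_def)
  have "AE p in ?M \<Otimes>\<^sub>M ?M. fst p \<notin> N \<and> snd p \<notin> N"
  proof (rule AE_pair_measure)
    have "{x \<in> space (?M \<Otimes>\<^sub>M ?M). fst x \<notin> N \<and> snd x \<notin> N} = (space ?M - N) \<times> (space ?M - N)"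
      by (auto simp: space_pair_measure)
    then show "{x \<in> space (?M \<Otimes>\<^sub>M ?M). fst x \<notin> N \<and> snd x \<notin> N} \<in> sets (?M \<Otimes>\<^sub>M ?M)"
      using N(2) by auto
    show "AE x in ?M. AE y in ?M. fst (x, y) \<notin> N \<and> snd (x, y) \<notin> N"
      using AE_not_in[OF N(2)] by auto
  qed
  then have "AE p in ?M \<Otimes>\<^sub>M ?M. ereal (norm (\<phi> (fst p) - \<phi> (snd p))) \<le> ereal (2 * R)"
  proof (rule AE_mp, intro AE_I2 impI)
    fix p assume p: "p \<in> space (?M \<Otimes>\<^sub>M ?M)" "fst p \<notin> N \<and> snd p \<notin> N"
    then have "norm (\<phi> (fst p) - v) \<le> R" "norm (\<phi> (snd p) - v) \<le> R"
      using N(1) by (auto simp: space_pair_measure)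
    then show "ereal (norm (\<phi> (fst p) - \<phi> (snd p))) \<le> ereal (2 * R)"
      by simp norm
  qed
  then show ?thesis
    unfolding osc_def by (intro Inf_lower) auto
qed

lemma osc_nonneg:
  assumes "U \<in> lmeasurable" and U: "0 < emeasure lebesgue U"
  shows "0 \<le> osc \<phi> U"
  unfolding osc_def
proof (rule Inf_greatest, rule ccontr)
  fix c :: ereal
  let ?M = "lebesgue_on U"
  assume c: "c \<in> {c. AE p in ?M \<Otimes>\<^sub>M ?M. ereal (norm (\<phi> (fst p) - \<phi> (snd p))) \<le> c}" "\<not> 0 \<le> c"
  have Us: "U \<in> sets lebesgue"
    using assms(1) by auto
  interpret finite_measure ?M
    using assms(1) by (rule finite_measure_lebesgue_on)
  have "\<not> ereal (norm x) \<le> c" for x :: 'a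
    using c(2) by (metis ereal_less_eq(5) norm_ge_zero order_trans)
  then have "AE p in ?M \<Otimes>\<^sub>M ?M. False"
    using c(1) by simp
  then have "emeasure (?M \<Otimes>\<^sub>M ?M) (space ?M \<times> space ?M) = 0"
    by (subst (asm) AE_iff_measurable[OF _ refl]) (auto simp: space_pair_measure)
  then have "emeasure lebesgue U * emeasure lebesgue U = 0"
    using Us by (subst (asm) emeasure_pair_measure_Times) (auto simp: emeasure_restrict_space)
  then show False
    using U by auto
qed

lemma osc_vector_derivative_le:
  fixes g :: "real \<Rightarrow> 'a::euclidean_space"
  assumes near: "velocity_near w e g (cball t d)" and "0 < \<delta>" "\<delta> < d" "{t-\<delta>..t+\<delta>} \<subseteq> {a<..<b}"
    and diff: "AE s in lebesgue. s \<in> {a<..<b} \<longrightarrow> g differentiable (at s)"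
  shows "osc (\<lambda>s. vector_derivative g (at s within {a..b})) {t-\<delta>..t+\<delta>} \<le> ereal (2 * e)"
proof (rule osc_le)
  have "AE s in lebesgue. s \<in> {t-\<delta>..t+\<delta>} \<longrightarrow> norm (vector_derivative g (at s within {a..b}) - w) \<le> e"
    using diff
  proof (eventually_elim, intro impI)
    fix s assume "s \<in> {a<..<b} \<longrightarrow> g differentiable (at s)" and s: "s \<in> {t-\<delta>..t+\<delta>}"
    moreover have ab: "s \<in> {a<..<b}"
      using s assms(4) by blast
    ultimately have der: "(g has_vector_derivative vector_derivative g (at s)) (at s)"
      using vector_derivative_works by blast
    have "locally_velocity_near w e g s"
      using s \<open>\<delta> < d\<close> near
      by (intro locally_velocity_nearI[of w e g "t - d" "t + d"]) (auto simp: cball_eq_atLeastAtMost)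
    from locally_velocity_near_vector_derivative[OF this der]
    show "norm (vector_derivative g (at s within {a..b}) - w) \<le> e"
      using ab by (simp add: at_within_Icc_at)
  qed
  then show "AE s in lebesgue_on {t-\<delta>..t+\<delta>}. norm (vector_derivative g (at s within {a..b}) - w) \<le> e"
    by (subst AE_restrict_space_iff) auto
qed simp

lemma osc_vector_derivative_tendsto_0:
  fixes g :: "real \<Rightarrow> 'a::euclidean_space"
  assumes near: "\<And>e. 0 < e \<Longrightarrow> \<exists>w. locally_velocity_near w e g t" and t: "t \<in> {a<..<b}"
    and diff: "AE s in lebesgue. s \<in> {a<..<b} \<longrightarrow> g differentiable (at s)"
  shows "((\<lambda>\<delta>. osc (\<lambda>s. vector_derivative g (at s within {a..b})) ({t-\<delta>..t+\<delta>} \<inter> {a..b})) \<longlongrightarrow> 0) (at_right 0)"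
    (is "(?osc \<longlongrightarrow> 0) _")
proof -
  define r where "r = min (t - a) (b - t)"
  have "0 < r" using t by (simp add: r_def)
  have inside: "{t-\<delta>..t+\<delta>} \<subseteq> {a<..<b}" if "\<delta> < r" for \<delta>
    using that by (auto simp: r_def)
  have Int_eq: "{t-\<delta>..t+\<delta>} \<inter> {a..b} = {t-\<delta>..t+\<delta>}" if "\<delta> < r" for \<delta>
    using inside[OF that] greaterThanLessThan_subseteq_atLeastAtMost_iff[of a b a b] by blast
  show ?thesis
  proof (rule order_tendstoI)
    fix c :: ereal assume "c < 0"
    then have "c < ?osc \<delta>" if "0 < \<delta>" "\<delta> < r" for \<delta>
      unfolding Int_eq[OF that(2)]
      using that(1) by (intro less_le_trans[OF _ osc_nonneg]) (auto simp: emeasure_lborel_Icc_eq)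
    then show "\<forall>\<^sub>F \<delta> in at_right 0. c < ?osc \<delta>"
      using \<open>0 < r\<close> by (auto simp: eventually_at_right_field)
  next
    fix c :: ereal assume "0 < c"
    then obtain e where e: "0 < ereal e" "ereal e < c"
      using ereal_dense2 by blast
    then obtain w d where d: "0 < d" "velocity_near w (e / 2) g (cball t d)"
      using near[of "e / 2"] by (auto simp: locally_velocity_near_def)
    have "?osc \<delta> < c" if "0 < \<delta>" "\<delta> < min d r" for \<delta>
      using osc_vector_derivative_le[OF d(2) that(1) _ inside diff] Int_eq[of \<delta>] that(2) e(2)
      by (auto intro: le_less_trans)
    then show "\<forall>\<^sub>F \<delta> in at_right 0. ?osc \<delta> < c"
      using \<open>0 < r\<close> d(1) by (auto simp: eventually_at_right_field intro!: exI[of _ "min d r"])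
  qed
qed

lemma lipschitz_curveI:
  fixes g :: "real \<Rightarrow> 'a::euclidean_space"
  assumes "a \<le> b" "L-lipschitz_on {a..b} g" "0 < c" "finite N"
    and diff: "AE t in lebesgue. t \<in> {a<..<b} \<longrightarrow> g differentiable (at t)"
    and near: "\<And>t. t \<in> {a<..<b} - N \<Longrightarrow> \<exists>w e. locally_velocity_near w e g t \<and> e + c \<le> norm w"
  shows "lipschitz_curve a b g"
proof -
  have "insert a (insert b N) \<in> null_sets lebesgue"
    using assms(4) by (simp add: negligible_finite flip: negligible_iff_null_sets)
  then have "AE t in lebesgue. t \<notin> insert a (insert b N)"
    by (rule AE_not_in)
  with diff have "AE t in lebesgue. t \<in> {a..b} \<longrightarrow> (\<exists>v. (g has_vector_derivative v) (at t within {a..b}) \<and> c \<le> norm v)"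
  proof (eventually_elim, intro impI)
    fix t assume "t \<in> {a<..<b} \<longrightarrow> g differentiable (at t)" "t \<notin> insert a (insert b N)" "t \<in> {a..b}"
    then have t: "t \<in> {a<..<b} - N" and "g differentiable (at t)" by auto
    then obtain v where v: "(g has_vector_derivative v) (at t)"
      using vector_derivative_works by blast
    obtain w e where w: "locally_velocity_near w e g t" "e + c \<le> norm w"
      using near[OF t] by blast
    have "norm w \<le> norm v + norm (v - w)"
      using norm_triangle_ineq4[of v "v - w"] by simp
    then have "c \<le> norm v"
      using locally_velocity_near_vector_derivative[OF w(1) v] w(2) by simp
    with v show "\<exists>v. (g has_vector_derivative v) (at t within {a..b}) \<and> c \<le> norm v"
      using has_vector_derivative_at_within by blast
  qed
  then have "AE t in lebesgue_on {a..b}. \<exists>v. (g has_vector_derivative v) (at t within {a..b}) \<and> c \<le> norm v"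
    by (subst AE_restrict_space_iff) auto
  then show ?thesis
    using assms(1-3) by (auto simp: lipschitz_curve_def)
qed

subsection \<open>Limits of local modifications\<close>

locale local_modifications =
  fixes g :: "nat \<Rightarrow> real \<Rightarrow> 'a::banach" and l r :: "nat \<Rightarrow> real" and L a b :: real
  assumes lipschitz: "L-lipschitz_on {a..b} (g n)"
    and window: "a \<le> l n" "l n \<le> r n" "r n \<le> b"
    and window_length: "r n - l n \<le> (1 / 8) ^ n"
    and unchanged: "t \<notin> {l n<..<r n} \<Longrightarrow> g (Suc n) t = g n t"
begin

lemma L_nonneg: "0 \<le> L"
  using lipschitz lipschitz_on_nonneg by blast

lemma norm_modification_le: "norm (g (Suc n) t - g n t) \<le> 2 * L * (1 / 8) ^ n"
proof (cases "t \<in> {l n<..<r n}")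
  case False
  then show ?thesis
    using L_nonneg by (simp add: unchanged)
next
  case True
  have "norm (g k t - g k (l n)) \<le> L * (1 / 8) ^ n" for k
  proof -
    have "norm (g k t - g k (l n)) \<le> L * norm (t - l n)"
      using True window[of n] by (intro lipschitz_on_normD[OF lipschitz]) auto
    also have "\<dots> \<le> L * (1 / 8) ^ n"
      using True window_length[of n] L_nonneg by (intro mult_left_mono) auto
    finally show ?thesis .
  qed
  from this[of "Suc n"] this[of n] unchanged[of "l n" n] show ?thesis
    using norm_triangle_ineq4[of "g (Suc n) t - g n (l n)" "g n t - g n (l n)"] by simp
qed

definition limit :: "real \<Rightarrow> 'a" where
  "limit t = lim (\<lambda>n. g n t)"

lemma tendsto_limit: "(\<lambda>n. g n t) \<longlonglongrightarrow> limit t"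
proof -
  have "summable (\<lambda>n. g (Suc n) t - g n t)"
  proof (rule summable_comparison_test')
    show "summable (\<lambda>n. 2 * L * (1 / 8) ^ n)"
      by (intro summable_mult summable_geometric) auto
  qed (rule norm_modification_le)
  then have "convergent (\<lambda>n. g n t - g 0 t)"
    using sum_lessThan_telescope[of "\<lambda>i. g i t"] by (simp add: summable_iff_convergent)
  then show ?thesis
    by (simp add: limit_def convergent_diff_const_right_iff convergent_LIMSEQ_iff)
qed

lemma limit_eq:
  assumes "\<And>j. k \<le> j \<Longrightarrow> t \<notin> {l j<..<r j}"
  shows "limit t = g k t"
proof -
  have "g n t = g k t" if "k \<le> n" for n
    using that
  proof (induction n rule: dec_induct)
    case (step n)
    then show ?case
      using unchanged[OF assms[of n]] by simp
  qed simp
  then have "(\<lambda>n. g n t) \<longlonglongrightarrow> g k t"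
    by (intro tendsto_eventually eventually_sequentiallyI[of k])
  then show ?thesis
    using tendsto_limit LIMSEQ_unique by blast
qed

lemma velocity_near_limit_curve:
  "(\<And>n. N \<le> n \<Longrightarrow> velocity_near w e (g n) X) \<Longrightarrow> velocity_near w e limit X"
  by (rule velocity_near_limit[OF _ tendsto_limit])

lemma lipschitz_on_limit: "L-lipschitz_on {a..b} limit"
  using velocity_near_limit_curve[of 0 0] lipschitz by (simp add: velocity_near_0)

text \<open>
  A modification at distance at least $2^{-n}$ from $t$ has size at most $2L \cdot 8^{-n}$. By Borel--Cantelli
  almost every $t$ is that far from all but finitely many modifications, so Rademacher's theorem is not needed.
\<close>

lemma norm_modification_le_quadratic:
  assumes "t \<notin> {l n - (1 / 2) ^ n..r n + (1 / 2) ^ n}"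
  shows "norm (g (Suc n) s - g n s) \<le> 2 * L * (s - t)\<^sup>2 * (1 / 2) ^ n"
proof (cases "s \<in> {l n<..<r n}")
  case False
  then show ?thesis
    using L_nonneg by (simp add: unchanged)
next
  case True
  then have "(1 / 2) ^ n \<le> \<bar>s - t\<bar>"
    using assms by auto
  then have "((1 / 2) ^ n)\<^sup>2 \<le> (s - t)\<^sup>2"
    using power_mono[of "(1 / 2) ^ n" "\<bar>s - t\<bar>" 2] by simp
  moreover have "(1 / 8 :: real) ^ n = ((1 / 2) ^ n)\<^sup>2 * (1 / 2) ^ n"
    by (simp add: power2_eq_square flip: power_mult_distrib)
  ultimately have "2 * L * (1 / 8) ^ n \<le> 2 * L * ((s - t)\<^sup>2 * (1 / 2) ^ n)"
    using L_nonneg by (intro mult_left_mono) (auto intro: mult_right_mono)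
  then show ?thesis
    using norm_modification_le[of n s] by (simp add: mult.assoc)
qed

lemma norm_limit_diff_le_quadratic:
  assumes far: "\<And>n. K \<le> n \<Longrightarrow> t \<notin> {l n - (1 / 2) ^ n..r n + (1 / 2) ^ n}"
  shows "norm (limit s - g K s) \<le> 4 * L * (s - t)\<^sup>2"
proof -
  let ?C = "2 * L * (s - t)\<^sup>2" and ?d = "\<lambda>n. g (Suc (n + K)) s - g (n + K) s"
  have "?d sums (limit s - g (0 + K) s)"
    using telescope_sums[OF LIMSEQ_ignore_initial_segment[OF tendsto_limit[of s], of K]] by simp
  then have "limit s - g K s = suminf ?d"
    by (simp add: sums_unique)
  also have "norm (suminf ?d) \<le> (\<Sum>n. ?C * (1 / 2) ^ n)"
  proof (rule norm_suminf_le)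
    show "summable (\<lambda>n. ?C * (1 / 2) ^ n)"
      by (intro summable_mult summable_geometric) auto
    fix n
    have "(1 / 2 :: real) ^ (n + K) \<le> (1 / 2) ^ n"
      by (intro power_decreasing) auto
    then have "?C * (1 / 2) ^ (n + K) \<le> ?C * (1 / 2) ^ n"
      using L_nonneg by (intro mult_left_mono) auto
    then show "norm (?d n) \<le> ?C * (1 / 2) ^ n"
      using norm_modification_le_quadratic[OF far[of "n + K"], of s] by simp
  qed
  also have "\<dots> = 4 * L * (s - t)\<^sup>2"
    by (subst suminf_mult) (auto simp: suminf_geometric)
  finally show ?thesis .
qed

lemma AE_far_from_windows:
  "AE t in lebesgue. \<exists>K. \<forall>n\<ge>K. t \<notin> {l n - (1 / 2) ^ n..r n + (1 / 2) ^ n}"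
proof -
  let ?A = "\<lambda>n. {l n - (1 / 2) ^ n..r n + (1 / 2) ^ n}"
  have "AE t in lebesgue. eventually (\<lambda>n. t \<in> space lebesgue - ?A n) sequentially"
  proof (rule borel_cantelli_AE1)
    show "?A n \<in> sets lebesgue" "emeasure lebesgue (?A n) < \<infinity>" for n
      by (auto simp: emeasure_lborel_Icc_eq)
    have le: "measure lebesgue (?A n) \<le> 3 * (1 / 2) ^ n" for n
    proof -
      have "measure lebesgue (?A n) = r n - l n + 2 * (1 / 2) ^ n"
        using window(2)[of n] zero_le_power[of "1 / 2 :: real" n] by (simp del: zero_le_power)
      moreover have "(1 / 8 :: real) ^ n \<le> (1 / 2) ^ n"
        by (intro power_mono) auto
      ultimately show ?thesis
        using window_length[of n] by simp
    qed
    have "summable (\<lambda>n. 3 * (1 / 2 :: real) ^ n)"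
      by (intro summable_mult summable_geometric) auto
    then show "summable (\<lambda>n. measure lebesgue (?A n))"
      by (rule summable_comparison_test'[where N = 0]) (use le in simp)
  qed
  then show ?thesis
    by eventually_elim (simp add: eventually_sequentially)
qed

lemma AE_limit_differentiable:
  assumes pw: "\<And>n. g n piecewise_differentiable_on {a..b}"
  shows "AE t in lebesgue. t \<in> {a<..<b} \<longrightarrow> limit differentiable (at t)"
proof -
  obtain N where N: "\<And>n. finite (N n)"
    "\<And>n t. t \<in> {a..b} - N n \<Longrightarrow> g n differentiable (at t within {a..b})"
    using pw unfolding piecewise_differentiable_on_def by metis
  have "countable (\<Union>n. N n)"
    using N(1) by (intro countable_UN) (auto intro: countable_finite)
  then have "(\<Union>n. N n) \<in> null_sets lebesgue"
    using countable_imp_null_set_lborel null_sets_completionI by blast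
  from AE_not_in[OF this] AE_far_from_windows show ?thesis
  proof (eventually_elim, intro impI)
    fix t assume "t \<notin> (\<Union>n. N n)" and t: "t \<in> {a<..<b}"
      and "\<exists>K. \<forall>n\<ge>K. t \<notin> {l n - (1 / 2) ^ n..r n + (1 / 2) ^ n}"
    then obtain K where K: "\<And>s. norm (limit s - g K s) \<le> 4 * L * (s - t)\<^sup>2"
      using norm_limit_diff_le_quadratic by metis
    have "g K differentiable (at t)"
      using N(2)[of t K] t \<open>t \<notin> (\<Union>n. N n)\<close> by (simp add: at_within_Icc_at)
    moreover have "(\<lambda>s. limit s - g K s) differentiable (at t)"
      using has_vector_derivative_zero_of_quadratic[OF K] by (rule differentiableI_vector)
    ultimately have "(\<lambda>s. g K s + (limit s - g K s)) differentiable (at t)"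
      by (rule differentiable_add)
    then show "limit differentiable (at t)" by simp
  qed
qed

end

subsection \<open>Stable directions\<close>

definition portion :: "'a::topological_space set \<Rightarrow> 'a set \<Rightarrow> bool" where
  "portion S V \<longleftrightarrow> open V \<and> V \<inter> S \<noteq> {}"

lemma portion_Int_dense:
  assumes "portion S V" "open H" "S \<subseteq> closure (S \<inter> H)"
  shows "portion S (V \<inter> H)"
  using assms open_Int_closure_eq_empty[of V "S \<inter> H"] by (auto simp: portion_def)

lemma portion_meets_finite_cover:
  assumes "finite C" "portion S V" and mono: "\<And>V W. V \<subseteq> W \<Longrightarrow> D V \<subseteq> D W"
    and meets: "\<And>W. portion S W \<Longrightarrow> W \<subseteq> V \<Longrightarrow> D W \<inter> (\<Union>c\<in>C. K c) \<noteq> {}"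
  shows "\<exists>c\<in>C. \<exists>V'\<subseteq>V. portion S V' \<and> (\<forall>W\<subseteq>V'. portion S W \<longrightarrow> D W \<inter> K c \<noteq> {})"
  using assms(1,2) meets
proof (induction C arbitrary: V rule: finite_induct)
  case empty
  then show ?case by fastforce
next
  case (insert c C)
  show ?case
  proof (cases "\<forall>W\<subseteq>V. portion S W \<longrightarrow> D W \<inter> K c \<noteq> {}")
    case True
    then show ?thesis using insert.prems(1) by blast
  next
    case False
    then obtain V0 where V0: "V0 \<subseteq> V" "portion S V0" "D V0 \<inter> K c = {}" by blast
    have "D W \<inter> (\<Union>c\<in>C. K c) \<noteq> {}" if "portion S W" "W \<subseteq> V0" for W
      using insert.prems(2)[of W] that V0(1,3) mono[OF that(2)] by blast
    from insert.IH[OF V0(2) this] show ?thesis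
      using V0(1) by (meson insertI2 order_trans)
  qed
qed

definition arc_into :: "'a::real_normed_vector set \<Rightarrow> real \<Rightarrow> real \<Rightarrow> (real \<Rightarrow> 'a) \<Rightarrow> real set \<Rightarrow> bool" where
  "arc_into A a b g P \<longleftrightarrow> a < b \<and> g piecewise_differentiable_on {a..b} \<and>
     compact P \<and> P \<subseteq> {a<..<b} \<and> 0 < measure lebesgue P \<and> g ` P \<subseteq> A"

lemma arc_into_mono: "arc_into A a b g P \<Longrightarrow> A \<subseteq> A' \<Longrightarrow> arc_into A' a b g P"
  by (auto simp: arc_into_def)

lemma arc_into_cong:
  assumes "\<And>t. t \<in> {a..b} \<Longrightarrow> g t = h t" "arc_into A a b g P"
  shows "arc_into A a b h P"
proof -
  have "h ` P = g ` P"
    using assms by (intro image_cong) (auto simp: arc_into_def subset_iff)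
  then show ?thesis
    using assms piecewise_differentiable_cong[of "{a..b}" g h] by (auto simp: arc_into_def)
qed

lemma arc_into_affine:
  assumes arc: "arc_into A (m * a + c) (m * b + c) g P" and m: "0 < m"
  shows "arc_into A a b (g \<circ> (\<lambda>s. m *\<^sub>R s + c)) ((\<lambda>t. (t - c) / m) ` P)"
proof -
  let ?\<psi> = "\<lambda>t. (1 / m) *\<^sub>R t + - c / m"
  have \<psi>: "(\<lambda>t. (t - c) / m) = ?\<psi>"
    by (simp add: diff_divide_distrib)
  have P: "compact P" "P \<subseteq> {m * a + c<..<m * b + c}" "0 < measure lebesgue P" "g ` P \<subseteq> A"
    using arc by (auto simp: arc_into_def)
  have "compact (?\<psi> ` P)"
    using P(1) by (intro compact_continuous_image continuous_intros)
  moreover have "0 < emeasure lebesgue (?\<psi> ` P)"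
    using P(1,3) m by (subst emeasure_lebesgue_affine) (auto simp: ennreal_zero_less_mult_iff measure_compact_pos_iff)
  moreover have "?\<psi> t \<in> {a<..<b}" if "t \<in> P" for t
  proof -
    have "m * a + c < t" "t < m * b + c"
      using P(2) that by auto
    then show ?thesis
      using m by (simp add: \<psi>[symmetric, THEN fun_cong] field_simps)
  qed
  moreover have "(\<lambda>s. m *\<^sub>R s + c) ` {a..b} = {m * a + c..m * b + c}" if "a \<le> b"
    using that m image_affinity_atLeastAtMost[of m c a b] by simp
  moreover have "a < b"
    using arc m by (simp add: arc_into_def)
  moreover have "(g \<circ> (\<lambda>s. m *\<^sub>R s + c)) ` ?\<psi> ` P = g ` P"
    using m by (simp add: image_comp o_def right_diff_distrib)
  moreover have "g piecewise_differentiable_on {m * a + c..m * b + c}"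
    using arc by (simp add: arc_into_def)
  ultimately show ?thesis
    using P(4) piecewise_differentiable_affine[of g m c "{a..b}"]
    unfolding arc_into_def \<psi> by (simp add: measure_compact_pos_iff image_subset_iff)
qed

definition arc_directions :: "'a::real_normed_vector set \<Rightarrow> 'a set \<Rightarrow> 'a set" where
  "arc_directions S V = {u. norm u = 1 \<and> (\<forall>m>0. \<forall>\<epsilon>>0. \<forall>\<delta>>0. \<forall>a. \<exists>b g P. b \<le> a + \<delta> \<and>
     arc_into (V \<inter> S) a b g P \<and> velocity_near (m *\<^sub>R u) \<epsilon> g {a..b})}"

lemma arc_directions_mono: "V \<subseteq> W \<Longrightarrow> arc_directions S V \<subseteq> arc_directions S W"
  unfolding arc_directions_def
  by (intro Collect_mono conj_mono all_mono imp_mono ex_mono order_refl) (auto elim: arc_into_mono)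

lemma C1_curve_arc_into:
  fixes \<nu> :: "real \<Rightarrow> 'a::real_normed_vector"
  assumes der: "\<And>t. t \<in> {0..1} \<Longrightarrow> (\<nu> has_vector_derivative \<nu>' t) (at t within {0..1})"
    and cont: "continuous_on {0..1} \<nu>'" and K: "compact K" "\<nu> ` K \<subseteq> A"
    and t0: "t0 \<in> lebesgue_support K" "0 < t0" "t0 < 1" and pos: "0 < \<epsilon>" "0 < \<delta>"
  obtains r where "0 < r" "r \<le> \<delta>" "velocity_near (\<nu>' t0) \<epsilon> \<nu> {t0 - r..t0 + r}"
    "arc_into A (t0 - r) (t0 + r) \<nu> (K \<inter> cball t0 (r / 2))"
proof -
  obtain d where d: "0 < d" "\<And>t. t \<in> {0..1} \<Longrightarrow> dist t t0 < d \<Longrightarrow> dist (\<nu>' t) (\<nu>' t0) < \<epsilon>"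
    using cont t0(2,3) pos(1) unfolding continuous_on_iff by (metis atLeastAtMost_iff less_imp_le)
  define r where "r = Min {d / 2, t0, 1 - t0, \<delta>}"
  have r: "0 < r" "r < d" "r \<le> t0" "r \<le> 1 - t0" "r \<le> \<delta>"
    using d(1) t0 pos by (auto simp: r_def min_def)
  have sub: "{t0 - r..t0 + r} \<subseteq> {0..1}"
    using r by auto
  have der': "(\<nu> has_vector_derivative \<nu>' t) (at t within {t0 - r..t0 + r})" if "t \<in> {t0 - r..t0 + r}" for t
    using that sub by (intro has_vector_derivative_within_subset[OF der]) auto
  have "velocity_near (\<nu>' t0) \<epsilon> \<nu> {t0 - r..t0 + r}"
  proof (rule velocity_near_of_has_vector_derivative[OF der'])
    fix t assume t: "t \<in> {t0 - r..t0 + r}"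
    then have "dist t t0 < d"
      using r(2) by (auto simp: dist_real_def)
    then show "norm (\<nu>' t - \<nu>' t0) \<le> \<epsilon>"
      using d(2)[of t] sub t by (auto simp: dist_norm)
  qed (use pos in auto)
  moreover have "0 < emeasure lebesgue (ball t0 (r / 2) \<inter> K)"
    using t0(1) r(1) by (simp add: lebesgue_support_def)
  then have "0 < emeasure lebesgue (K \<inter> cball t0 (r / 2))"
    using K(1) by (elim less_le_trans) (intro emeasure_mono fmeasurableD lmeasurable_compact compact_Int_closed, auto)
  then have "0 < measure lebesgue (K \<inter> cball t0 (r / 2))"
    using K(1) by (simp add: measure_compact_pos_iff compact_Int_closed)
  moreover have "K \<inter> cball t0 (r / 2) \<subseteq> {t0 - r<..<t0 + r}"
    using r(1) by (auto simp: cball_eq_atLeastAtMost)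
  moreover have "\<nu> piecewise_differentiable_on {t0 - r..t0 + r}"
    using der' by (intro differentiable_imp_piecewise_differentiable) (auto intro: differentiableI_vector)
  ultimately show thesis
    using that[of r] r K by (auto simp: arc_into_def compact_Int_closed)
qed

lemma C1_curve_arc_into_with_speed:
  fixes \<nu> :: "real \<Rightarrow> 'a::real_normed_vector"
  assumes \<nu>: "\<And>t. t \<in> {0..1} \<Longrightarrow> (\<nu> has_vector_derivative \<nu>' t) (at t within {0..1})" "continuous_on {0..1} \<nu>'"
    and K: "compact K" "\<nu> ` K \<subseteq> A" and t0: "t0 \<in> lebesgue_support K" "0 < t0" "t0 < 1"
    and pos: "0 < q" "0 < \<epsilon>" "0 < \<delta>"
  shows "\<exists>b g P. b \<le> a + \<delta> \<and> arc_into A a b g P \<and> velocity_near (q *\<^sub>R \<nu>' t0) \<epsilon> g {a..b}"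
proof -
  obtain r where r: "0 < r" "r \<le> q * \<delta> / 2" "velocity_near (\<nu>' t0) (\<epsilon> / q) \<nu> {t0 - r..t0 + r}"
    "arc_into A (t0 - r) (t0 + r) \<nu> (K \<inter> cball t0 (r / 2))"
    by (rule C1_curve_arc_into[OF \<nu> K t0, of "\<epsilon> / q" "q * \<delta> / 2"]) (use pos in auto)
  define b c where "b = a + 2 * r / q" and "c = t0 - r - q * a"
  have ends: "q * a + c = t0 - r" "q * b + c = t0 + r"
    using pos(1) by (simp_all add: b_def c_def distrib_left)
  have "a \<le> b" "b \<le> a + \<delta>"
    using pos(1) r(1,2) by (simp_all add: b_def field_simps)
  then have "(\<lambda>s. q *\<^sub>R s + c) ` {a..b} = {t0 - r..t0 + r}"
    using pos(1) image_affinity_atLeastAtMost[of q c a b] by (simp add: ends)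
  then have "velocity_near (q *\<^sub>R \<nu>' t0) \<epsilon> (\<nu> \<circ> (\<lambda>s. q *\<^sub>R s + c)) {a..b}"
    using velocity_near_affine[of "\<nu>' t0" "\<epsilon> / q" \<nu> q c "{a..b}"] r(3) pos(1) by simp
  moreover have "arc_into A a b (\<nu> \<circ> (\<lambda>s. q *\<^sub>R s + c)) ((\<lambda>t. (t - c) / q) ` (K \<inter> cball t0 (r / 2)))"
    using r(4) pos(1) by (intro arc_into_affine) (simp_all only: ends)
  ultimately show ?thesis
    using \<open>b \<le> a + \<delta>\<close> by metis
qed

lemma exists_density_time:
  fixes S :: "'a::euclidean_space set"
  assumes S: "every_portion_pos_cone_width S" and U: "portion S U"
  obtains \<nu> \<nu>' K t where "\<And>t. t \<in> {0..1} \<Longrightarrow> (\<nu> has_vector_derivative \<nu>' t) (at t within {0..1})"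
    "continuous_on {0..1} \<nu>'" "\<And>t. t \<in> {0..1} \<Longrightarrow> \<nu>' t \<noteq> 0"
    "compact K" "\<nu> ` K \<subseteq> U \<inter> S" "t \<in> lebesgue_support K" "0 < t" "t < 1"
proof -
  obtain \<nu> :: "real \<Rightarrow> 'a" and \<nu>' where
    \<nu>: "\<And>t. t \<in> {0..1} \<Longrightarrow> (\<nu> has_vector_derivative \<nu>' t) (at t within {0..1})"
      "continuous_on {0..1} \<nu>'" "\<And>t. t \<in> {0..1} \<Longrightarrow> \<nu>' t \<noteq> 0"
    and pos: "0 < emeasure lebesgue {t\<in>{0..1}. \<nu> t \<in> U \<inter> S}"
    using S[unfolded every_portion_pos_cone_width_def, rule_format, OF U[unfolded portion_def]] by blast
  let ?T = "{t\<in>{0..1}. \<nu> t \<in> U \<inter> S}"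
  have "{0, 1} \<in> null_sets lebesgue"
    using negligible_finite[of "{0, 1::real}"] by (simp add: negligible_iff_null_sets)
  moreover have "?T \<in> sets lebesgue"
    using pos emeasure_notin_sets by fastforce
  ultimately have "0 < emeasure lebesgue (?T - {0, 1})"
    using pos by (metis emeasure_Diff_null_set)
  moreover have "bounded (?T - {0, 1})"
    by (rule bounded_subset[of "{0..1::real}"]) auto
  ultimately obtain K where K: "compact K" "K \<subseteq> ?T - {0, 1}" "0 < measure lebesgue K"
    by (rule exists_compact_subset_pos_measure)
  then have "K \<inter> lebesgue_support K \<noteq> {}"
    using lmeasurable_compact by (intro lebesgue_support_meets) (auto simp: measure_compact_pos_iff)
  then obtain t where "t \<in> K" "t \<in> lebesgue_support K" by blast
  then show thesis
    using that[OF \<nu>, of K t] K by (force simp: order_less_le)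
qed

lemma arc_directions_nonempty:
  fixes S :: "'a::euclidean_space set"
  assumes "every_portion_pos_cone_width S" "portion S U"
  shows "arc_directions S U \<noteq> {}"
proof -
  obtain \<nu> \<nu>' K t0 where \<nu>: "\<And>t. t \<in> {0..1} \<Longrightarrow> (\<nu> has_vector_derivative \<nu>' t) (at t within {0..1})"
    "continuous_on {0..1} \<nu>'" "\<And>t. t \<in> {0..1} \<Longrightarrow> \<nu>' t \<noteq> 0"
    and K: "compact K" "\<nu> ` K \<subseteq> U \<inter> S" and t0: "t0 \<in> lebesgue_support K" "0 < t0" "t0 < 1"
    using exists_density_time[OF assms] by blast
  define v where "v = \<nu>' t0"
  have "v \<noteq> 0"
    using \<nu>(3) t0 by (simp add: v_def)
  have "\<exists>b g P. b \<le> a + \<delta> \<and> arc_into (U \<inter> S) a b g P \<and> velocity_near (m *\<^sub>R (v /\<^sub>R norm v)) \<epsilon> g {a..b}"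
    if pos: "0 < m" "0 < \<epsilon>" "0 < \<delta>" for m \<epsilon> \<delta> a :: real
    using C1_curve_arc_into_with_speed[OF \<nu>(1,2) K t0, of "m / norm v" \<epsilon> \<delta> a] pos \<open>v \<noteq> 0\<close>
    by (simp add: divide_inverse flip: v_def)
  then have "v /\<^sub>R norm v \<in> arc_directions S U"
    using \<open>v \<noteq> 0\<close> by (simp add: arc_directions_def)
  then show ?thesis by blast
qed

definition stable_direction :: "'a::real_normed_vector set \<Rightarrow> 'a set \<Rightarrow> 'a \<Rightarrow> real \<Rightarrow> bool" where
  "stable_direction S V v e \<longleftrightarrow> norm v = 1 \<and> portion S V \<and>
     (\<forall>W\<subseteq>V. portion S W \<longrightarrow> arc_directions S W \<inter> cball v e \<noteq> {})"

lemma stable_direction_UNIV: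
  fixes S :: "'a::euclidean_space set"
  assumes S: "every_portion_pos_cone_width S" "S \<noteq> {}" and v: "norm v = 1"
  shows "stable_direction S UNIV v 2"
  unfolding stable_direction_def
proof (intro conjI allI impI)
  show "portion S UNIV"
    using S(2) by (simp add: portion_def)
  fix W assume "portion S W"
  then obtain u where u: "u \<in> arc_directions S W"
    using arc_directions_nonempty[OF S(1)] by blast
  then have "dist v u \<le> 2"
    using v norm_triangle_ineq4[of v u] by (simp add: arc_directions_def dist_norm)
  then show "arc_directions S W \<inter> cball v 2 \<noteq> {}"
    using u by auto
qed (rule v)

lemma stable_direction_refine:
  fixes S :: "'a::euclidean_space set"
  assumes st: "stable_direction S V v \<kappa>" and W: "portion S W" "W \<subseteq> V" and e: "0 < e"
  obtains W' w where "W' \<subseteq> W" "stable_direction S W' w e" "norm (w - v) \<le> \<kappa> + e"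
proof -
  obtain C where C: "finite C" "C \<subseteq> sphere (0::'a) 1" "sphere 0 1 \<subseteq> (\<Union>c\<in>C. ball c e)"
    using seq_compact_imp_totally_bounded[rule_format, OF compact_imp_seq_compact[OF compact_sphere[of "0::'a" 1]] e]
    by (elim exE conjE) (rule that)
  let ?K = "\<lambda>c. cball v \<kappa> \<inter> cball c e"
  have meets: "arc_directions S X \<inter> (\<Union>c\<in>C. ?K c) \<noteq> {}" if X: "portion S X" "X \<subseteq> W" for X
  proof -
    have "arc_directions S X \<inter> cball v \<kappa> \<noteq> {}"
      using st X W(2) by (meson order_trans stable_direction_def)
    then obtain u where u: "u \<in> arc_directions S X" "u \<in> cball v \<kappa>" by blast
    then have "u \<in> sphere 0 1"
      by (simp add: arc_directions_def)
    then have "u \<in> (\<Union>c\<in>C. ball c e)"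
      using C(3) by (rule subsetD[rotated])
    then obtain c where "c \<in> C" "u \<in> cball c e"
      by (auto intro: less_imp_le)
    then show ?thesis
      using u by blast
  qed
  have "\<exists>w\<in>C. \<exists>W'\<subseteq>W. portion S W' \<and> (\<forall>X\<subseteq>W'. portion S X \<longrightarrow> arc_directions S X \<inter> ?K w \<noteq> {})"
    by (rule portion_meets_finite_cover[OF C(1) W(1) arc_directions_mono meets])
  then obtain w W' where w: "w \<in> C" "W' \<subseteq> W" "portion S W'"
    and meets': "\<forall>X\<subseteq>W'. portion S X \<longrightarrow> arc_directions S X \<inter> ?K w \<noteq> {}"
    by (elim bexE exE conjE) (rule that)
  then have "\<forall>X\<subseteq>W'. portion S X \<longrightarrow> arc_directions S X \<inter> cball w e \<noteq> {}"
    by (metis Int_assoc Int_commute Int_empty_right)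
  then have "stable_direction S W' w e"
    using C(2) w(1,3) by (auto simp: stable_direction_def)
  moreover have "arc_directions S W' \<inter> ?K w \<noteq> {}"
    using meets' w(3) by blast
  then obtain u where "dist v u \<le> \<kappa>" "dist w u \<le> e"
    by auto
  then have "norm (w - v) \<le> \<kappa> + e"
    using dist_triangle2[of w v u] by (simp add: dist_norm)
  ultimately show thesis
    using that w(2) by blast
qed

subsection \<open>Stable arcs and grafting\<close>

text \<open>
  Only the restriction of \<open>curve\<close> to the interval from \<open>arc_lo\<close> to \<open>arc_hi\<close> describes the arc; grafts extend it
  to \<open>[0, 1]\<close>. The times in \<open>core\<close> are those at which later arcs may be grafted.
\<close>

record 'a timed_arc =
  curve :: "real \<Rightarrow> 'a"
  arc_lo :: real
  arc_hi :: real
  velocity :: 'a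
  region :: "'a set"
  core :: "real set"

abbreviation arc_times :: "('a, 'b) timed_arc_scheme \<Rightarrow> real set" where
  "arc_times r \<equiv> {arc_lo r..arc_hi r}"

abbreviation arc_interior :: "('a, 'b) timed_arc_scheme \<Rightarrow> real set" where
  "arc_interior r \<equiv> {arc_lo r<..<arc_hi r}"

locale stable_arc =
  fixes S H :: "'a::euclidean_space set" and e :: real and r :: "('a, 'b) timed_arc_scheme"
  assumes arc: "arc_into (region r \<inter> S) (arc_lo r) (arc_hi r) (curve r) (core r)"
    and arc_length: "arc_hi r - arc_lo r \<le> e"
    and stable: "stable_direction S (region r) (velocity r) e"
    and lipschitz_arc: "(1 - e)-lipschitz_on (arc_times r) (curve r)"
    and velocity_near_arc: "velocity_near (velocity r) (4 * e) (curve r) (arc_times r)"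
    and cball_subset: "cball (curve r (arc_lo r)) (arc_hi r - arc_lo r) \<subseteq> H"
begin

lemma arc_pos: "arc_lo r < arc_hi r"
  using arc by (simp add: arc_into_def)

lemma core_compact: "compact (core r)" and core_subset: "core r \<subseteq> arc_interior r"
  and core_pos: "0 < measure lebesgue (core r)" and curve_core: "curve r ` core r \<subseteq> region r \<inter> S"
  using arc by (auto simp: arc_into_def)

lemma norm_velocity: "norm (velocity r) = 1"
  using stable by (simp add: stable_direction_def)

lemma tolerance_pos: "0 < e"
  using arc_pos arc_length by simp

lemma dist_curve_le:
  assumes "s \<in> arc_times r" "t \<in> arc_times r"
  shows "dist (curve r s) (curve r t) \<le> arc_hi r - arc_lo r"
proof -
  have "dist (curve r s) (curve r t) \<le> (1 - e) * dist s t"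
    using lipschitz_onD[OF lipschitz_arc assms] .
  also have "\<dots> \<le> 1 * (arc_hi r - arc_lo r)"
    using assms tolerance_pos by (intro mult_mono) (auto simp: dist_real_def)
  finally show ?thesis by simp
qed

lemma core_point:
  obtains c where "c \<in> core r" "c \<in> arc_times r" "curve r c \<in> region r" "curve r c \<in> S"
proof -
  obtain c where "c \<in> core r"
    using core_pos by (metis all_not_in_conv less_irrefl measure_empty)
  then show thesis
    using that core_subset curve_core by fastforce
qed

lemma dist_curve_le_of_region:
  assumes "region r \<subseteq> ball y \<rho>" "arc_hi r - arc_lo r \<le> \<rho>" "t \<in> arc_times r"
  shows "dist (curve r t) y \<le> 2 * \<rho>"
proof -
  obtain c where c: "c \<in> arc_times r" "curve r c \<in> region r"
    by (rule core_point)
  then have "dist (curve r c) y < \<rho>"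
    using assms(1) by (auto simp: dist_commute)
  then show ?thesis
    using dist_curve_le[OF assms(3) c(1)] assms(2) dist_triangle[of "curve r t" y "curve r c"] by simp
qed

end

lemma stable_arc_cong:
  fixes r :: "('a::euclidean_space, 'b) timed_arc_scheme" and \<alpha> :: "('a, 'c) timed_arc_scheme"
  assumes \<alpha>: "stable_arc S H e \<alpha>" and eq: "\<And>t. t \<in> arc_times \<alpha> \<Longrightarrow> curve r t = curve \<alpha> t"
    and fields: "arc_lo r = arc_lo \<alpha>" "arc_hi r = arc_hi \<alpha>"
      "velocity r = velocity \<alpha>" "region r = region \<alpha>" "core r = core \<alpha>"
  shows "stable_arc S H e r"
proof
  interpret \<alpha>: stable_arc S H e \<alpha> by (rule \<alpha>)
  show "arc_into (region r \<inter> S) (arc_lo r) (arc_hi r) (curve r) (core r)"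
    using arc_into_cong[OF eq[symmetric] \<alpha>.arc] by (simp add: fields)
  show "(1 - e)-lipschitz_on (arc_times r) (curve r)"
    using lipschitz_on_transform[OF \<alpha>.lipschitz_arc eq] by (simp add: fields)
  show "velocity_near (velocity r) (4 * e) (curve r) (arc_times r)"
    using \<alpha>.velocity_near_arc velocity_near_cong[of "arc_times \<alpha>" "curve r" "curve \<alpha>"] eq by (simp add: fields)
  have "curve r (arc_lo \<alpha>) = curve \<alpha> (arc_lo \<alpha>)"
    using \<alpha>.arc_pos by (simp add: eq)
  then show "cball (curve r (arc_lo r)) (arc_hi r - arc_lo r) \<subseteq> H"
    using \<alpha>.cball_subset by (simp add: fields)
qed (use stable_arc.arc_length[OF \<alpha>] stable_arc.stable[OF \<alpha>] in \<open>simp_all add: fields\<close>)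

lemma slowed_arc_bounds:
  assumes near: "velocity_near ((1 - 2 * e) *\<^sub>R u) e g X"
    and u: "norm u = 1" "norm (u - v) \<le> e" and e: "0 < e" "e \<le> 1 / 4"
  shows "(1 - e)-lipschitz_on X g" and "velocity_near v (4 * e) g X"
proof -
  show "(1 - e)-lipschitz_on X g"
    using velocity_near_imp_lipschitz[OF near] u(1) e by simp
  have "norm ((1 - 2 * e) *\<^sub>R u - v) \<le> norm (u - v) + norm ((2 * e) *\<^sub>R u)"
    using norm_triangle_ineq4[of "u - v" "(2 * e) *\<^sub>R u"] by (simp add: algebra_simps)
  then show "velocity_near v (4 * e) g X"
    using u e(1) by (intro velocity_near_mono[OF velocity_near_change[OF near]]) auto
qed

lemma arc_into_cball_subset_ball:
  assumes arc: "arc_into A a b g P" and A: "A \<subseteq> ball z (\<sigma> / 2)" and lip: "L-lipschitz_on {a..b} g" "L \<le> 1"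
    and short: "b - a \<le> \<sigma> / 4"
  shows "cball (g a) (b - a) \<subseteq> ball z \<sigma>"
proof -
  have "a < b" "P \<subseteq> {a<..<b}" "g ` P \<subseteq> ball z (\<sigma> / 2)" "P \<noteq> {}"
    using arc A by (auto simp: arc_into_def)
  then obtain c where c: "a < c" "c < b" "dist z (g c) < \<sigma> / 2"
    by fastforce
  then have "dist (g a) (g c) \<le> L * dist a c"
    by (intro lipschitz_onD[OF lip(1)]) auto
  also have "\<dots> \<le> 1 * (\<sigma> / 4)"
    using c lip(2) short by (intro mult_mono) (auto simp: dist_real_def)
  finally have "dist z (g a) < 3 * \<sigma> / 4"
    using c(3) dist_triangle[of z "g a" "g c"] by (simp add: dist_commute)
  show ?thesis
  proof
    fix y assume "y \<in> cball (g a) (b - a)"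
    then show "y \<in> ball z \<sigma>"
      using \<open>dist z (g a) < 3 * \<sigma> / 4\<close> short dist_triangle[of z y "g a"] by simp
  qed
qed

lemma portion_contains_ball:
  assumes "portion S V"
  obtains z \<sigma> where "z \<in> S" "0 < \<sigma>" "ball z \<sigma> \<subseteq> V"
  using assms unfolding portion_def by (metis IntE equals0I openE)

lemma exists_stable_arc:
  fixes S :: "'a::euclidean_space set"
  assumes st: "stable_direction S V v \<kappa>" and W: "portion S W" "W \<subseteq> V" and H: "open H" "S \<subseteq> closure (S \<inter> H)"
    and e: "0 < e" "e \<le> 1 / 4" and "0 < \<delta>"
  obtains \<alpha> :: "'a timed_arc" where "stable_arc S H e \<alpha>" "arc_lo \<alpha> = a" "arc_hi \<alpha> \<le> a + \<delta>"
    "region \<alpha> \<subseteq> W" "norm (velocity \<alpha> - v) \<le> \<kappa> + e"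
proof -
  obtain z \<sigma> where z: "z \<in> S" "0 < \<sigma>" "ball z \<sigma> \<subseteq> W \<inter> H"
    by (rule portion_contains_ball[OF portion_Int_dense[OF W(1) H]])
  have "z \<in> ball z (\<sigma> / 2) \<inter> S"
    using z(1,2) by simp
  then have half: "ball z (\<sigma> / 2) \<subseteq> ball z \<sigma>" "portion S (ball z (\<sigma> / 2))"
    unfolding portion_def using z(2) by (auto simp del: Int_iff)
  then have sub: "ball z (\<sigma> / 2) \<subseteq> V"
    using z(3) W(2) by blast
  obtain V' v' where V': "V' \<subseteq> ball z (\<sigma> / 2)" "stable_direction S V' v' e" "norm (v' - v) \<le> \<kappa> + e"
    by (rule stable_direction_refine[OF st half(2) sub e(1)])
  then have "arc_directions S V' \<inter> cball v' e \<noteq> {}"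
    by (simp add: stable_direction_def)
  then obtain u where u: "u \<in> arc_directions S V'" "norm (u - v') \<le> e"
    by (auto simp: dist_norm norm_minus_commute)
  define \<delta>' where "\<delta>' = Min {\<delta>, e, \<sigma> / 4}"
  then have "0 < \<delta>'"
    using e \<open>0 < \<delta>\<close> z(2) by simp
  then have "\<exists>b g P. b \<le> a + \<delta>' \<and> arc_into (V' \<inter> S) a b g P \<and> velocity_near ((1 - 2 * e) *\<^sub>R u) e g {a..b}"
    using u(1) e by (simp add: arc_directions_def)
  then obtain b g P where arc: "arc_into (V' \<inter> S) a b g P" and "b \<le> a + \<delta>'"
    and near: "velocity_near ((1 - 2 * e) *\<^sub>R u) e g {a..b}"
    by blast
  then have b: "b \<le> a + \<delta>" "b - a \<le> e" "b - a \<le> \<sigma> / 4"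
    by (auto simp: \<delta>'_def)
  have "norm u = 1"
    using u(1) by (simp add: arc_directions_def)
  note bounds = slowed_arc_bounds[OF near this u(2) e]
  define \<alpha> where "\<alpha> = \<lparr>curve = g, arc_lo = a, arc_hi = b, velocity = v', region = V', core = P\<rparr>"
  have \<alpha>: "curve \<alpha> = g" "arc_lo \<alpha> = a" "arc_hi \<alpha> = b" "velocity \<alpha> = v'" "region \<alpha> = V'" "core \<alpha> = P"
    by (simp_all add: \<alpha>_def)
  have "cball (g a) (b - a) \<subseteq> H"
    using arc_into_cball_subset_ball[OF arc _ bounds(1) _ b(3), of z] V'(1) e(1) z(3) by auto
  then have "stable_arc S H e \<alpha>"
    using arc b(2) V'(2) bounds by unfold_locales (simp_all add: \<alpha>)
  then show thesis
    using that[of \<alpha>] b(1) V'(1,3) half(1) z(3) by (auto simp: \<alpha>)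
qed

record 'a node = "'a timed_arc" +
  zone_lo :: real
  zone_hi :: real

abbreviation zone :: "'a node \<Rightarrow> real set" where
  "zone r \<equiv> {zone_lo r..zone_hi r}"

locale graft =
  fixes \<eta> :: real and \<beta> :: "real \<Rightarrow> 'a::real_normed_vector" and r :: "'a node"
  assumes order: "zone_lo r < arc_lo r" "arc_lo r < arc_hi r" "arc_hi r < zone_hi r"
    and outside: "t \<notin> {zone_lo r<..<zone_hi r} \<Longrightarrow> curve r t = \<beta> t"
    and left: "\<exists>d. norm d \<le> \<eta> \<and> (\<forall>t\<in>{zone_lo r..arc_lo r}. curve r t = \<beta> t + (t - zone_lo r) *\<^sub>R d)"
    and right: "\<exists>d. norm d \<le> \<eta> \<and> (\<forall>t\<in>{arc_hi r..zone_hi r}. curve r t = \<beta> t + (t - zone_hi r) *\<^sub>R d)"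
begin

lemma velocity_near_correction:
  assumes "velocity_near w e \<beta> X" "norm d \<le> \<eta>" "e + \<eta> \<le> L" "\<And>t. t \<in> X \<Longrightarrow> curve r t = \<beta> t + (t - c) *\<^sub>R d"
  shows "velocity_near w L (curve r) X"
proof -
  have "velocity_near (w + d) (e + 0) (\<lambda>t. \<beta> t + (0 + (t - c) *\<^sub>R d)) X"
    by (intro velocity_near_add assms(1) velocity_near_linear)
  from velocity_near_change[OF this, of w] have "velocity_near w (e + norm d) (curve r) X"
    using velocity_near_cong[OF assms(4)] by simp
  then show ?thesis
    by (rule velocity_near_mono) (use assms(2,3) in auto)
qed

lemma velocity_near_left:
  assumes "velocity_near w L \<beta> {a..zone_lo r}" "velocity_near w e \<beta> (zone r)" "e + \<eta> \<le> L"
  shows "velocity_near w L (curve r) {a..arc_lo r}"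
proof (rule velocity_near_join[of _ _ _ _ "zone_lo r"])
  show "velocity_near w L (curve r) {a..zone_lo r}"
    using assms(1) order by (subst velocity_near_cong[of _ _ \<beta>]) (auto intro: outside)
  have "velocity_near w e \<beta> {zone_lo r..arc_lo r}"
    using order by (intro velocity_near_mono[OF assms(2)]) auto
  then show "velocity_near w L (curve r) {zone_lo r..arc_lo r}"
    using left assms(3) velocity_near_correction by blast
qed

lemma velocity_near_right:
  assumes "velocity_near w L \<beta> {zone_hi r..b}" "velocity_near w e \<beta> (zone r)" "e + \<eta> \<le> L"
  shows "velocity_near w L (curve r) {arc_hi r..b}"
proof (rule velocity_near_join[of _ _ _ _ "zone_hi r"])
  show "velocity_near w L (curve r) {zone_hi r..b}"
    using assms(1) order by (subst velocity_near_cong[of _ _ \<beta>]) (auto intro: outside)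
  have "velocity_near w e \<beta> {arc_hi r..zone_hi r}"
    using order by (intro velocity_near_mono[OF assms(2)]) auto
  then show "velocity_near w L (curve r) {arc_hi r..zone_hi r}"
    using right assms(3) velocity_near_correction by blast
qed

lemma velocity_near_curve:
  assumes "zone r \<subseteq> {a..b}" "velocity_near w L \<beta> {a..b}" "velocity_near w e \<beta> (zone r)" "e + \<eta> \<le> L"
    and "velocity_near w L (curve r) (arc_times r)"
  shows "velocity_near w L (curve r) {a..b}"
proof -
  have "a \<le> zone_lo r" "zone_hi r \<le> b"
    using assms(1) order by (auto simp: atLeastatMost_subset_iff)
  then have "velocity_near w L \<beta> {a..zone_lo r}" "velocity_near w L \<beta> {zone_hi r..b}"
    using order by (auto intro!: velocity_near_mono[OF assms(2)])
  from velocity_near_left[OF this(1) assms(3,4)] velocity_near_right[OF this(2) assms(3,4)]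
  show ?thesis
    by (rule velocity_near_join[OF velocity_near_join[OF _ assms(5)]])
qed

lemma piecewise_differentiable_curve:
  assumes "zone r \<subseteq> {a..b}" "\<beta> piecewise_differentiable_on {a..b}"
    and arc: "curve r piecewise_differentiable_on (arc_times r)"
  shows "curve r piecewise_differentiable_on {a..b}"
proof -
  have ab: "a \<le> zone_lo r" "zone_hi r \<le> b"
    using assms(1) order by (auto simp: atLeastatMost_subset_iff)
  have corrected: "curve r piecewise_differentiable_on {s..t}"
    if "{s..t} \<subseteq> {a..b}" "\<And>u. u \<in> {s..t} \<Longrightarrow> curve r u = \<beta> u + (u - c) *\<^sub>R d" for s t c d
  proof (rule piecewise_differentiable_cong)
    show "(\<lambda>u. \<beta> u + (u - c) *\<^sub>R d) piecewise_differentiable_on {s..t}"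
      using that(1) by (intro piecewise_differentiable_add piecewise_differentiable_on_subset[OF assms(2)]
          differentiable_imp_piecewise_differentiable differentiable_scaleR derivative_intros) auto
  qed (use that(2) in simp)
  have "curve r piecewise_differentiable_on {a..zone_lo r}" "curve r piecewise_differentiable_on {zone_hi r..b}"
    using ab order outside by (auto intro!: corrected[where d = 0])
  moreover have "curve r piecewise_differentiable_on {zone_lo r..arc_lo r}"
    "curve r piecewise_differentiable_on {arc_hi r..zone_hi r}"
    using left right ab order by (auto elim!: exE intro!: corrected)
  ultimately show ?thesis
    using arc ab order by (meson piecewise_differentiable_join less_imp_le order_trans)
qed

lemma norm_curve_diff_le:
  assumes "t \<notin> arc_interior r"
  shows "norm (curve r t - \<beta> t) \<le> \<eta> * (zone_hi r - zone_lo r)"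
proof -
  have "0 \<le> \<eta>"
    using left norm_ge_zero order_trans by blast
  have scaled: "norm ((t - c) *\<^sub>R d) \<le> \<eta> * (zone_hi r - zone_lo r)"
    if "norm d \<le> \<eta>" "c \<in> zone r" "t \<in> zone r" for c d
    using that \<open>0 \<le> \<eta>\<close> mult_mono[of "\<bar>t - c\<bar>" "zone_hi r - zone_lo r" "norm d" \<eta>] by (auto simp: mult.commute)
  consider "t \<notin> {zone_lo r<..<zone_hi r}" | "t \<in> {zone_lo r..arc_lo r}" | "t \<in> {arc_hi r..zone_hi r}"
    using assms by fastforce
  then show ?thesis
  proof cases
    case 1
    then show ?thesis
      using order \<open>0 \<le> \<eta>\<close> by (simp add: outside)
  next
    case 2
    then show ?thesis
      using left scaled[of _ "zone_lo r"] order by auto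
  next
    case 3
    then show ?thesis
      using right scaled[of _ "zone_hi r"] order by auto
  qed
qed

end

lemma exists_graft_of_arc:
  fixes \<alpha> :: "'a::euclidean_space timed_arc"
  assumes \<alpha>: "stable_arc S H e \<alpha>" and order: "a < arc_lo \<alpha>" "arc_hi \<alpha> < b"
    and gaps: "norm (curve \<alpha> (arc_lo \<alpha>) - \<beta> (arc_lo \<alpha>)) \<le> \<eta> * (arc_lo \<alpha> - a)"
      "norm (curve \<alpha> (arc_hi \<alpha>) - \<beta> (arc_hi \<alpha>)) \<le> \<eta> * (b - arc_hi \<alpha>)"
  obtains r where "graft \<eta> \<beta> r" "stable_arc S H e r" "zone_lo r = a" "zone_hi r = b"
    "arc_lo r = arc_lo \<alpha>" "velocity r = velocity \<alpha>"
proof -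
  interpret \<alpha>: stable_arc S H e \<alpha> by (rule \<alpha>)
  let ?l = "arc_lo \<alpha>" and ?h = "arc_hi \<alpha>"
  note order = order \<alpha>.arc_pos
  define d d' where "d = (curve \<alpha> ?l - \<beta> ?l) /\<^sub>R (?l - a)" and "d' = (curve \<alpha> ?h - \<beta> ?h) /\<^sub>R (?h - b)"
  have d: "norm d \<le> \<eta>" "(?l - a) *\<^sub>R d = curve \<alpha> ?l - \<beta> ?l"
    using gaps(1) order by (simp_all add: d_def divide_simps mult.commute)
  have d': "norm d' \<le> \<eta>" "(?h - b) *\<^sub>R d' = curve \<alpha> ?h - \<beta> ?h"
    using gaps(2) order by (simp_all add: d'_def divide_simps mult.commute)
  define g where "g t = (if t \<in> {?l..?h} then curve \<alpha> t else if t \<in> {a..?l} then \<beta> t + (t - a) *\<^sub>R d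
     else if t \<in> {?h..b} then \<beta> t + (t - b) *\<^sub>R d' else \<beta> t)" for t
  define r where "r = timed_arc.extend (\<alpha>\<lparr>curve := g\<rparr>) \<lparr>zone_lo = a, zone_hi = b\<rparr>"
  have r: "curve r = g" "arc_lo r = ?l" "arc_hi r = ?h" "velocity r = velocity \<alpha>" "region r = region \<alpha>"
    "core r = core \<alpha>" "zone_lo r = a" "zone_hi r = b"
    by (simp_all add: r_def timed_arc.extend_def)
  have "graft \<eta> \<beta> r"
  proof
    show "curve r t = \<beta> t" if "t \<notin> {zone_lo r<..<zone_hi r}" for t
      using that order by (cases "t = a"; cases "t = b") (auto simp: r g_def)
    have "curve r t = \<beta> t + (t - a) *\<^sub>R d" if "t \<in> {a..?l}" for t
      using that order d(2) by (cases "t = ?l") (auto simp: r g_def)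
    then show "\<exists>d. norm d \<le> \<eta> \<and> (\<forall>t\<in>{zone_lo r..arc_lo r}. curve r t = \<beta> t + (t - zone_lo r) *\<^sub>R d)"
      using d(1) by (auto simp: r)
    have "curve r t = \<beta> t + (t - b) *\<^sub>R d'" if "t \<in> {?h..b}" for t
      using that order d'(2) by (cases "t = ?h") (auto simp: r g_def)
    then show "\<exists>d. norm d \<le> \<eta> \<and> (\<forall>t\<in>{arc_hi r..zone_hi r}. curve r t = \<beta> t + (t - zone_hi r) *\<^sub>R d)"
      using d'(1) by (auto simp: r)
  qed (use order in \<open>simp_all add: r\<close>)
  moreover have "stable_arc S H e r"
    by (rule stable_arc_cong[OF \<alpha>]) (simp_all add: r g_def)
  ultimately show thesis
    using that r by blast
qed

lemma exists_graft:
  fixes S :: "'a::euclidean_space set"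
  assumes st: "stable_direction S V v \<kappa>" and x: "\<beta> x \<in> V" "\<beta> x \<in> S" and h: "0 < h"
    and lip: "1-lipschitz_on {x - h..x + h} \<beta>" and H: "open H" "S \<subseteq> closure (S \<inter> H)"
    and e: "0 < e" "e \<le> 1 / 4" and \<eta>: "0 < \<eta>" "\<eta> \<le> 1"
  obtains r where "graft \<eta> \<beta> r" "stable_arc S H e r" "zone_lo r = x - h" "arc_lo r = x" "zone_hi r = x + h"
    "norm (velocity r - v) \<le> \<kappa> + e"
proof -
  define \<rho> where "\<rho> = \<eta> * h / 8"
  have \<rho>: "0 < \<rho>" "\<eta> * h = 8 * \<rho>" "8 * \<rho> \<le> h"
    using \<eta> h mult_right_mono[OF \<eta>(2), of h] by (auto simp: \<rho>_def)
  have "\<beta> x \<in> (V \<inter> ball (\<beta> x) \<rho>) \<inter> S"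
    using x \<rho>(1) by simp
  moreover have "open V"
    using st by (simp add: stable_direction_def portion_def)
  ultimately have W: "portion S (V \<inter> ball (\<beta> x) \<rho>)"
    unfolding portion_def by blast
  obtain \<alpha> :: "'a timed_arc" where \<alpha>: "stable_arc S H e \<alpha>" "arc_lo \<alpha> = x" "arc_hi \<alpha> \<le> x + \<rho>"
    "region \<alpha> \<subseteq> V \<inter> ball (\<beta> x) \<rho>" "norm (velocity \<alpha> - v) \<le> \<kappa> + e"
    by (rule exists_stable_arc[OF st W Int_lower1 H e \<rho>(1), of x])
  interpret \<alpha>: stable_arc S H e \<alpha> by (rule \<alpha>(1))
  let ?b = "arc_hi \<alpha>"
  have b: "x < ?b" "?b < x + h"
    using \<alpha>.arc_pos \<alpha>(2,3) \<rho>(1,3) by linarith+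
  have near: "dist (curve \<alpha> t) (\<beta> x) \<le> 2 * \<rho>" if "t \<in> {x..?b}" for t
    using \<alpha>(2-4) that by (intro \<alpha>.dist_curve_le_of_region) auto
  obtain r where "graft \<eta> \<beta> r" "stable_arc S H e r" "zone_lo r = x - h" "zone_hi r = x + h"
    "arc_lo r = arc_lo \<alpha>" "velocity r = velocity \<alpha>"
  proof (rule exists_graft_of_arc[OF \<alpha>(1), of "x - h" "x + h" \<beta> \<eta>])
    show "norm (curve \<alpha> (arc_lo \<alpha>) - \<beta> (arc_lo \<alpha>)) \<le> \<eta> * (arc_lo \<alpha> - (x - h))"
      using near[of x] b(1) \<rho> by (simp add: \<alpha>(2) dist_norm)
    have "dist (\<beta> x) (\<beta> ?b) \<le> 1 * dist x ?b"
      using b h by (intro lipschitz_onD[OF lip]) auto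
    then have "dist (curve \<alpha> ?b) (\<beta> ?b) \<le> 3 * \<rho>"
      using near[of ?b] b(1) \<alpha>(3) dist_triangle[of "curve \<alpha> ?b" "\<beta> ?b" "\<beta> x"] by (simp add: dist_real_def)
    also have "\<dots> \<le> \<eta> * (h / 2)"
      using \<rho> by simp
    also have "\<dots> \<le> \<eta> * (x + h - ?b)"
      using \<eta> \<alpha>(3) \<rho> by (intro mult_left_mono) auto
    finally show "norm (curve \<alpha> ?b - \<beta> ?b) \<le> \<eta> * (x + h - ?b)"
      by (simp add: dist_norm)
  qed (use h b \<alpha>(2) in auto)
  then show thesis
    using that \<alpha>(2,5) by simp
qed

subsection \<open>Chains of grafted arcs\<close>

definition tol :: "nat \<Rightarrow> real" where
  "tol k = (1 / 2) ^ k / 32"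

lemma tol_pos: "0 < tol k" and tol_le: "tol k \<le> 1 / 32"
  by (auto simp: tol_def power_le_one)

lemma tol_mono: "j \<le> k \<Longrightarrow> tol k \<le> tol j"
  by (simp add: tol_def power_decreasing)

lemma two_tol_le: "j < k \<Longrightarrow> 2 * tol k \<le> tol j"
  using power_decreasing[of "Suc j" k "1 / 2 :: real"] by (simp add: tol_def)

lemma exists_tol_less:
  assumes "0 < e"
  shows "\<exists>n. \<forall>k\<ge>n. tol k < e"
proof -
  obtain n where "(1 / 2) ^ n < 32 * e"
    using real_arch_pow_inv[of "32 * e" "1 / 2"] assms by auto
  then have "tol n < e"
    by (simp add: tol_def)
  then show ?thesis
    using tol_mono le_less_trans by blast
qed

lemma arc_interior_subset_times: "arc_interior r \<subseteq> arc_times r"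
  by auto

locale stable_node = stable_arc S H e r
  for S H :: "'a::euclidean_space set" and e :: real and r :: "'a node" +
  assumes zone_bounds: "0 < zone_lo r" "zone_lo r < arc_lo r" "arc_hi r < zone_hi r" "zone_hi r < 1"
    and lipschitz: "1-lipschitz_on {0..1} (curve r)"
    and piecewise_differentiable: "curve r piecewise_differentiable_on {0..1}"
begin

lemma zone_less: "zone_lo r < zone_hi r"
  using zone_bounds arc_pos by simp

lemma arc_times_subset_zone: "arc_times r \<subseteq> zone r"
  using zone_bounds by auto

lemma arc_interior_subset_zone: "arc_interior r \<subseteq> zone r"
  using zone_bounds by auto

lemma zone_subset: "zone r \<subseteq> {0..1}"
  using zone_bounds by auto

end

lemma stable_node_of_graft:
  assumes "stable_arc S H e r" "graft \<eta> \<beta> r" and zone: "0 < zone_lo r" "zone_hi r < 1"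
    and lip: "1-lipschitz_on {0..1} \<beta>" "(1 - \<eta>)-lipschitz_on (zone r) \<beta>"
    and pw: "\<beta> piecewise_differentiable_on {0..1}"
  shows "stable_node S H e r"
proof -
  interpret stable_arc S H e r by fact
  interpret graft \<eta> \<beta> r by fact
  have zone_subset: "zone r \<subseteq> {0..1}"
    using zone by auto
  have "1-lipschitz_on (arc_times r) (curve r)"
    using lipschitz_on_le[OF lipschitz_arc] tolerance_pos by simp
  then have "1-lipschitz_on {0..1} (curve r)"
    using velocity_near_curve[OF zone_subset, of 0 1 "1 - \<eta>"] lip by (simp add: velocity_near_0)
  moreover have "curve r piecewise_differentiable_on {0..1}"
    using arc by (intro piecewise_differentiable_curve[OF zone_subset pw]) (simp add: arc_into_def)
  ultimately show ?thesis
    using zone order by unfold_locales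
qed

definition root_node :: "'a::euclidean_space set \<Rightarrow> 'a set \<Rightarrow> 'a node \<Rightarrow> bool" where
  "root_node S H r \<longleftrightarrow> stable_node S H (tol 0) r \<and> curve r ` ({0..1} - arc_interior r) \<subseteq> H \<and>
     (\<exists>w e. e < norm w \<and> velocity_near w e (curve r) {0..arc_lo r} \<and> velocity_near w e (curve r) {arc_hi r..1})"

text \<open>
  On arc \<open>j\<close> the curve starts out within \<open>4 * tol j\<close> of the prescribed velocity; the bound \<open>8 * tol j\<close> leaves room
  for the affine corrections and turns of all later grafts.
\<close>

definition compatible :: "nat \<Rightarrow> 'a::euclidean_space node \<Rightarrow> nat \<Rightarrow> 'a node \<Rightarrow> bool" where
  "compatible j q k r \<longleftrightarrow>
     (zone r \<inter> zone q = {} \<or>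
      zone r \<subseteq> arc_interior q \<and> norm (velocity r - velocity q) + 8 * tol k \<le> 8 * tol j) \<and>
     velocity_near (velocity q) (8 * tol j) (curve r) (arc_times q) \<and>
     (zone_hi r - zone_lo r) * 2 ^ (k + 2) \<le> measure lebesgue (core q)"

definition untouched :: "(nat \<Rightarrow> 'a node) \<Rightarrow> nat \<Rightarrow> nat set \<Rightarrow> real set" where
  "untouched f p J = core (f p) - (\<Union>j\<in>J. zone (f j))"

text \<open>
  Step \<open>n\<close> serves the pair \<open>(p, i) = prod_decode n\<close>: it grafts inside arc \<open>p\<close> and, if \<open>B i\<close> contains a core time not
  covered so far, inside \<open>B i\<close>. As every pair is served, each neighbourhood of a remaining time receives a graft.
\<close>

definition extends :: "(nat \<Rightarrow> real set) \<Rightarrow> (nat \<Rightarrow> 'a node) \<Rightarrow> nat \<Rightarrow> 'a node \<Rightarrow> bool" where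
  "extends B f n r \<longleftrightarrow>
     (\<forall>t. t \<notin> {zone_lo r<..<zone_hi r} \<longrightarrow> curve r t = curve (f n) t) \<and>
     zone_hi r - zone_lo r \<le> (1 / 8) ^ n \<and>
     (case prod_decode n of (p, i) \<Rightarrow> zone r \<subseteq> arc_interior (f p) \<and>
       (untouched f p {p<..n} \<inter> B i = {} \<or> zone r \<subseteq> B i))"

fun admissible ::
  "'a::euclidean_space set \<Rightarrow> (nat \<Rightarrow> 'a set) \<Rightarrow> (nat \<Rightarrow> real set) \<Rightarrow> (nat \<Rightarrow> 'a node) \<Rightarrow> nat \<Rightarrow> 'a node \<Rightarrow> bool"
where
  "admissible S G B f 0 r \<longleftrightarrow> root_node S (G 0) r"
| "admissible S G B f (Suc n) r \<longleftrightarrow>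
     stable_node S (G (Suc n)) (tol (Suc n)) r \<and> (\<forall>j\<le>n. compatible j (f j) (Suc n) r) \<and> extends B f n r"

lemma admissible_stable_node: "admissible S G B f k r \<Longrightarrow> stable_node S (G k) (tol k) r"
  by (cases k) (auto simp: root_node_def)

lemma admissible_compatible: "admissible S G B f k r \<Longrightarrow> j < k \<Longrightarrow> compatible j (f j) k r"
  by (cases k) (auto simp: less_Suc_eq_le)

lemma prod_decode_fst_le: "prod_decode n = (p, i) \<Longrightarrow> p \<le> n"
  by (metis le_prod_encode_1 prod_decode_inverse)

lemma untouched_cong: "f p = g p \<Longrightarrow> (\<And>j. j \<in> J \<Longrightarrow> f j = g j) \<Longrightarrow> untouched f p J = untouched g p J"
  by (simp add: untouched_def)

lemma admissible_cong:
  assumes "\<And>j. j < k \<Longrightarrow> f j = g j"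
  shows "admissible S G B f k r \<longleftrightarrow> admissible S G B g k r"
proof (cases k)
  case (Suc n)
  obtain p i where pi: "prod_decode n = (p, i)" by force
  have "untouched f p {p<..n} = untouched g p {p<..n}"
    using assms prod_decode_fst_le[OF pi] Suc by (intro untouched_cong) auto
  then have "extends B f n r \<longleftrightarrow> extends B g n r"
    using assms prod_decode_fst_le[OF pi] Suc by (simp add: extends_def pi)
  then show ?thesis
    using assms Suc by (simp add: less_Suc_eq_le)
qed simp

lemma emeasure_untouched_pos:
  assumes node: "stable_node S H e (f p)" and zones: "\<And>j. j \<in> J \<Longrightarrow> zone_lo (f j) \<le> zone_hi (f j)"
    and compatible: "\<And>j. j \<in> J \<Longrightarrow> compatible p (f p) j (f j)"
  shows "0 < emeasure lebesgue (untouched f p J)"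
  unfolding untouched_def
proof (rule emeasure_Diff_UN_pos)
  interpret stable_node S H e "f p" by (rule node)
  show "core (f p) \<in> lmeasurable" "0 < measure lebesgue (core (f p))"
    using core_compact core_pos by (auto simp: lmeasurable_compact)
  fix j assume "j \<in> J"
  then show "measure lebesgue (zone (f j)) * 2 ^ (j + 2) \<le> measure lebesgue (core (f p))"
    using compatible zones by (simp add: compatible_def)
qed simp

locale node_prefix =
  fixes S :: "'a::euclidean_space set" and G :: "nat \<Rightarrow> 'a set" and B :: "nat \<Rightarrow> real set"
    and f :: "nat \<Rightarrow> 'a node" and n :: nat
  assumes admissible: "j \<le> n \<Longrightarrow> admissible S G B f j (f j)"
    and open_G: "open (G k)" and dense_G: "S \<subseteq> closure (S \<inter> G k)"
    and open_B: "open (B i)"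
begin

lemma node_stable: "j \<le> n \<Longrightarrow> stable_node S (G j) (tol j) (f j)"
  using admissible admissible_stable_node by blast

lemma compatible: "j < k \<Longrightarrow> k \<le> n \<Longrightarrow> compatible j (f j) k (f k)"
  using admissible admissible_compatible by blast

lemma curve_eq_ancestor:
  assumes "p \<le> n" "\<And>j. p < j \<Longrightarrow> j \<le> n \<Longrightarrow> t \<notin> zone (f j)"
  shows "curve (f n) t = curve (f p) t"
proof -
  have "curve (f m) t = curve (f p) t" if "p \<le> m" "m \<le> n" for m
    using that
  proof (induction m rule: dec_induct)
    case (step m)
    then have "extends B f m (f (Suc m))" "t \<notin> zone (f (Suc m))"
      using admissible[of "Suc m"] assms(2) by auto
    then show ?case
      using step by (auto simp: extends_def)
  qed simp
  then show ?thesis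
    using assms(1) by blast
qed

lemma untouched_nonempty:
  assumes p: "p \<le> n"
  shows "untouched f p {p<..n} \<noteq> {}"
proof -
  have "0 < emeasure lebesgue (untouched f p {p<..n})"
  proof (rule emeasure_untouched_pos)
    show "stable_node S (G p) (tol p) (f p)" by (rule node_stable[OF p])
    fix j assume "j \<in> {p<..n}"
    then show "zone_lo (f j) \<le> zone_hi (f j)" "compatible p (f p) j (f j)"
      using stable_node.zone_less[OF node_stable] compatible by (auto intro: less_imp_le)
  qed
  then show ?thesis by force
qed

lemma exists_small_radius:
  assumes "0 < h0"
  shows "\<exists>h>0. h \<le> h0 \<and> 2 * h \<le> (1 / 8) ^ n \<and> (\<forall>j\<le>n. 2 * h * 2 ^ (Suc n + 2) \<le> measure lebesgue (core (f j)))"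
proof -
  define \<mu> where "\<mu> = Min ((\<lambda>j. measure lebesgue (core (f j))) ` {..n})"
  have "0 < measure lebesgue (core (f j))" if "j \<le> n" for j
    using stable_arc.core_pos[OF stable_node.axioms(1)[OF node_stable[OF that]]] .
  then have \<mu>: "0 < \<mu>" "\<And>j. j \<le> n \<Longrightarrow> \<mu> \<le> measure lebesgue (core (f j))"
    unfolding \<mu>_def by (subst Min_gr_iff, auto)
  define h where "h = Min {h0, (1 / 8) ^ n / 2, \<mu> / (2 * 2 ^ (Suc n + 2))}"
  have "0 < h" "h \<le> h0" "h \<le> (1 / 8) ^ n / 2" "h \<le> \<mu> / (2 * 2 ^ (Suc n + 2))"
    using assms \<mu>(1) by (auto simp: h_def)
  then have "0 < h" "h \<le> h0" "2 * h \<le> (1 / 8) ^ n" "2 * h * 2 ^ (Suc n + 2) \<le> \<mu>"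
    by (auto simp: field_simps)
  then show ?thesis
    using \<mu>(2) by (meson order_trans)
qed

lemma exists_graft_site:
  assumes p: "p \<le> n"
  obtains x h where "x \<in> core (f p)" "0 < h" "{x - h..x + h} \<subseteq> arc_interior (f p)"
    "\<forall>j\<in>{p<..n}. {x - h..x + h} \<inter> zone (f j) = {}"
    "untouched f p {p<..n} \<inter> B i = {} \<or> {x - h..x + h} \<subseteq> B i"
    "2 * h \<le> (1 / 8) ^ n" "\<forall>j\<le>n. 2 * h * 2 ^ (Suc n + 2) \<le> measure lebesgue (core (f j))"
proof -
  interpret p: stable_node S "G p" "tol p" "f p" by (rule node_stable[OF p])
  let ?U = "untouched f p {p<..n}"
  obtain x where x: "x \<in> ?U" and xB: "?U \<inter> B i = {} \<or> x \<in> B i"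
    using untouched_nonempty[OF p] by blast
  define C where "C = (if ?U \<inter> B i = {} then UNIV else B i)"
  define W where "W = (arc_interior (f p) - (\<Union>j\<in>{p<..n}. zone (f j))) \<inter> C"
  have "open W"
    unfolding W_def C_def using open_B by (intro open_Int open_Diff closed_UN) auto
  moreover have "x \<in> W"
    using x xB p.core_subset by (auto simp: untouched_def W_def C_def)
  ultimately obtain h0 where h0: "0 < h0" "cball x h0 \<subseteq> W"
    using open_contains_cball by blast
  obtain h where h: "0 < h" "h \<le> h0" "2 * h \<le> (1 / 8) ^ n"
    "\<forall>j\<le>n. 2 * h * 2 ^ (Suc n + 2) \<le> measure lebesgue (core (f j))"
    using exists_small_radius[OF h0(1)] by blast
  then have sub: "{x - h..x + h} \<subseteq> W"
    using h0(2) by (auto simp: cball_eq_atLeastAtMost)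
  show thesis
  proof (rule that[OF _ h(1) _ _ _ h(3,4)])
    show "x \<in> core (f p)"
      using x by (simp add: untouched_def)
    show "{x - h..x + h} \<subseteq> arc_interior (f p)" "\<forall>j\<in>{p<..n}. {x - h..x + h} \<inter> zone (f j) = {}"
      using sub unfolding W_def by blast+
    show "?U \<inter> B i = {} \<or> {x - h..x + h} \<subseteq> B i"
      using sub by (simp add: W_def C_def split: if_splits)
  qed
qed

end

locale graft_step =
  node_prefix S G B f n + stable_arc S "G (Suc n)" "tol (Suc n)" r + graft "tol p" "curve (f n)" r
  for S :: "'a::euclidean_space set" and G B f n p r +
  fixes i :: nat
  assumes decode: "prod_decode n = (p, i)"
    and inside: "zone r \<subseteq> arc_interior (f p)"
    and avoids: "p < j \<Longrightarrow> j \<le> n \<Longrightarrow> zone r \<inter> zone (f j) = {}"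
    and scheduled: "untouched f p {p<..n} \<inter> B i = {} \<or> zone r \<subseteq> B i"
    and zone_length: "zone_hi r - zone_lo r \<le> (1 / 8) ^ n"
    and zone_small: "j \<le> n \<Longrightarrow> (zone_hi r - zone_lo r) * 2 ^ (Suc n + 2) \<le> measure lebesgue (core (f j))"
    and turn: "norm (velocity r - velocity (f p)) \<le> tol p + tol (Suc n)"
begin

lemma p_le: "p \<le> n"
  using decode by (rule prod_decode_fst_le)

sublocale parent: stable_node S "G p" "tol p" "f p"
  by (rule node_stable[OF p_le])

lemma tol_parent: "2 * tol (Suc n) \<le> tol p"
  using p_le by (intro two_tol_le) simp

lemma curve_eq_parent: "t \<in> zone r \<Longrightarrow> curve (f n) t = curve (f p) t"
  using avoids by (intro curve_eq_ancestor[OF p_le]) blast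

lemma zone_subset_parent: "zone r \<subseteq> arc_times (f p)"
  using inside arc_interior_subset_times by blast

lemma lipschitz_on_zone: "(1 - tol p)-lipschitz_on (zone r) (curve (f n))"
  using lipschitz_on_subset[OF parent.lipschitz_arc zone_subset_parent] curve_eq_parent
  by (rule lipschitz_on_transform)

lemma velocity_near_on_zone: "velocity_near (velocity (f p)) (4 * tol p) (curve (f n)) (zone r)"
  using velocity_near_mono[OF parent.velocity_near_arc zone_subset_parent order_refl]
    velocity_near_cong[of "zone r" "curve (f n)" "curve (f p)"] curve_eq_parent by blast

lemma stable_node_graft: "stable_node S (G (Suc n)) (tol (Suc n)) r"
proof (rule stable_node_of_graft[OF stable_arc_axioms graft_axioms _ _ _ lipschitz_on_zone])
  interpret last: stable_node S "G n" "tol n" "f n" by (rule node_stable) simp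
  show "1-lipschitz_on {0..1} (curve (f n))" "curve (f n) piecewise_differentiable_on {0..1}"
    by (fact last.lipschitz last.piecewise_differentiable)+
  have "zone_lo r \<in> zone r" "zone_hi r \<in> zone r"
    using order by auto
  then have "zone_lo r \<in> arc_interior (f p)" "zone_hi r \<in> arc_interior (f p)"
    using inside by blast+
  then show "0 < zone_lo r" "zone_hi r < 1"
    using parent.zone_bounds by auto
qed

lemma nested_or_disjoint:
  assumes "j \<le> n"
  shows "zone r \<inter> zone (f j) = {} \<or>
    zone r \<subseteq> arc_interior (f j) \<and> norm (velocity (f p) - velocity (f j)) + 8 * tol p \<le> 8 * tol j"
proof -
  consider "j = p" | "p < j" | "j < p" by linarith
  then show ?thesis
  proof cases
    case 1
    then show ?thesis using inside by simp
  next
    case 2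
    then show ?thesis using avoids assms by blast
  next
    case 3
    then show ?thesis
      using compatible[OF 3 p_le] inside parent.arc_interior_subset_zone unfolding compatible_def by blast
  qed
qed

lemma velocity_near_older:
  assumes j: "j \<le> n"
  shows "velocity_near (velocity (f j)) (8 * tol j) (curve (f n)) (arc_times (f j))"
proof (cases "j = n")
  case True
  interpret last: stable_node S "G n" "tol n" "f n" by (rule node_stable) simp
  show ?thesis
    using velocity_near_mono[OF last.velocity_near_arc order_refl, of "8 * tol n"] tol_pos[of n] by (simp add: True)
next
  case False
  then show ?thesis
    using compatible[of j n] j by (simp add: compatible_def)
qed

lemma turn_older:
  "norm (velocity r - velocity (f j)) + 8 * tol (Suc n) \<le> norm (velocity (f p) - velocity (f j)) + 8 * tol p"
  using norm_triangle_ineq[of "velocity r - velocity (f p)" "velocity (f p) - velocity (f j)"]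
    turn tol_parent tol_pos[of p] by simp

lemma velocity_near_graft_older:
  assumes j: "j \<le> n"
  shows "velocity_near (velocity (f j)) (8 * tol j) (curve r) (arc_times (f j))"
  using nested_or_disjoint[OF j]
proof
  interpret j: stable_node S "G j" "tol j" "f j" by (rule node_stable[OF j])
  assume disjoint: "zone r \<inter> zone (f j) = {}"
  have "curve r t = curve (f n) t" if "t \<in> arc_times (f j)" for t
  proof -
    have "t \<notin> zone r"
      using disjoint that j.arc_times_subset_zone by blast
    then show ?thesis
      by (intro outside) auto
  qed
  then show ?thesis
    using velocity_near_older[OF j] velocity_near_cong by blast
next
  assume nested: "zone r \<subseteq> arc_interior (f j) \<and> norm (velocity (f p) - velocity (f j)) + 8 * tol p \<le> 8 * tol j"
  show ?thesis
  proof (rule velocity_near_curve)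
    show "zone r \<subseteq> arc_times (f j)"
      using nested arc_interior_subset_times by blast
    show "velocity_near (velocity (f j)) (8 * tol j) (curve (f n)) (arc_times (f j))"
      by (rule velocity_near_older[OF j])
    show "velocity_near (velocity (f j)) (4 * tol p + norm (velocity (f p) - velocity (f j))) (curve (f n)) (zone r)"
      by (rule velocity_near_change[OF velocity_near_on_zone])
    show "4 * tol p + norm (velocity (f p) - velocity (f j)) + tol p \<le> 8 * tol j"
      using nested tol_pos[of p] by simp
    have "4 * tol (Suc n) + norm (velocity r - velocity (f j)) \<le> 8 * tol j"
      using turn_older[of j] nested tol_pos[of "Suc n"] by simp
    then show "velocity_near (velocity (f j)) (8 * tol j) (curve r) (arc_times r)"
      by (rule velocity_near_mono[OF velocity_near_change[OF velocity_near_arc] order_refl])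
  qed
qed

lemma compatible_graft:
  assumes j: "j \<le> n"
  shows "compatible j (f j) (Suc n) r"
proof -
  have "zone r \<inter> zone (f j) = {} \<or>
      zone r \<subseteq> arc_interior (f j) \<and> norm (velocity r - velocity (f j)) + 8 * tol (Suc n) \<le> 8 * tol j"
    using nested_or_disjoint[OF j] turn_older[of j] by (meson order_trans)
  then show ?thesis
    using velocity_near_graft_older[OF j] zone_small[OF j] unfolding compatible_def by blast
qed

lemma extends_graft: "extends B f n r"
  using outside zone_length inside scheduled by (simp add: extends_def decode)

end

lemma (in node_prefix) exists_next_node: "\<exists>r. admissible S G B f (Suc n) r"
proof -
  obtain p i where pi: "prod_decode n = (p, i)" by force
  then have p: "p \<le> n" by (rule prod_decode_fst_le)
  interpret p: stable_node S "G p" "tol p" "f p" by (rule node_stable[OF p])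
  obtain x h where x: "x \<in> core (f p)" and h: "0 < h"
    and site: "{x - h..x + h} \<subseteq> arc_interior (f p)" "\<forall>j\<in>{p<..n}. {x - h..x + h} \<inter> zone (f j) = {}"
      "untouched f p {p<..n} \<inter> B i = {} \<or> {x - h..x + h} \<subseteq> B i" "2 * h \<le> (1 / 8) ^ n"
      "\<forall>j\<le>n. 2 * h * 2 ^ (Suc n + 2) \<le> measure lebesgue (core (f j))"
    by (rule exists_graft_site[OF p, of i])
  have "x \<notin> zone (f j)" if "p < j" "j \<le> n" for j
    using bspec[OF site(2), of j] that h by auto
  then have "curve (f n) x = curve (f p) x"
    by (rule curve_eq_ancestor[OF p])
  then have \<beta>x: "curve (f n) x \<in> region (f p)" "curve (f n) x \<in> S"
    using x p.curve_core by auto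
  have "{x - h..x + h} \<subseteq> {0..1}"
    using site(1) p.arc_interior_subset_zone p.zone_subset by blast
  then have lip: "1-lipschitz_on {x - h..x + h} (curve (f n))"
    using stable_node.lipschitz[OF node_stable[OF order_refl]] lipschitz_on_subset by blast
  have tols: "tol (Suc n) \<le> 1 / 4" "tol p \<le> 1"
    using tol_le[of "Suc n"] tol_le[of p] by simp_all
  obtain r where r: "graft (tol p) (curve (f n)) r" "stable_arc S (G (Suc n)) (tol (Suc n)) r"
    "zone_lo r = x - h" "arc_lo r = x" "zone_hi r = x + h" "norm (velocity r - velocity (f p)) \<le> tol p + tol (Suc n)"
    by (rule exists_graft[where H = "G (Suc n)", OF p.stable \<beta>x h lip open_G dense_G tol_pos tols(1) tol_pos tols(2)])
  interpret graft_step S G B f n p r i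
  proof (intro graft_step.intro node_prefix_axioms r(1,2) graft_step_axioms.intro pi)
    have zone: "zone r = {x - h..x + h}" "zone_hi r - zone_lo r = 2 * h"
      by (simp_all add: r)
    show "zone r \<subseteq> arc_interior (f p)" "untouched f p {p<..n} \<inter> B i = {} \<or> zone r \<subseteq> B i"
      "zone_hi r - zone_lo r \<le> (1 / 8) ^ n"
      unfolding zone by (fact site)+
    show "zone r \<inter> zone (f j) = {}" if "p < j" "j \<le> n" for j
      using site(2) that unfolding zone by simp
    show "(zone_hi r - zone_lo r) * 2 ^ (Suc n + 2) \<le> measure lebesgue (core (f j))" if "j \<le> n" for j
      using site(5) that unfolding zone by blast
  qed (rule r(6))
  show ?thesis
    using stable_node_graft compatible_graft extends_graft by auto
qed

lemma root_node_of_graft: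
  fixes z w :: "'a::euclidean_space"
  assumes \<sigma>: "0 < \<sigma>" "\<sigma> \<le> 1" "cball z \<sigma> \<subseteq> H" and w: "norm w = \<sigma> / 4"
    and \<beta>: "\<beta> = (\<lambda>t. z + (t - 1 / 2) *\<^sub>R w)" and graft: "graft (\<sigma> / 8) \<beta> r"
    and stable: "stable_arc S H (tol 0) r" and zone: "zone_lo r = 1 / 4" "zone_hi r = 3 / 4"
  shows "root_node S H r"
proof -
  interpret graft "\<sigma> / 8" \<beta> r by (rule graft)
  have near: "velocity_near w 0 \<beta> X" "velocity_near w (\<sigma> / 8) \<beta> X" for X
    using velocity_near_linear[of w z "1 / 2" X] velocity_near_mono[of w 0 \<beta> X X "\<sigma> / 8"] \<sigma>(1) by (auto simp: \<beta>)
  have lip: "(\<sigma> / 4)-lipschitz_on X \<beta>" for X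
    using velocity_near_imp_lipschitz[OF near(1)] w by simp
  have "stable_node S H (tol 0) r"
  proof (rule stable_node_of_graft[OF stable graft])
    show "1-lipschitz_on {0..1} \<beta>" "(1 - \<sigma> / 8)-lipschitz_on (zone r) \<beta>"
      using \<sigma>(2) by (auto intro: lipschitz_on_le[OF lip])
    show "\<beta> piecewise_differentiable_on {0..1}"
      unfolding \<beta>
      by (intro differentiable_imp_piecewise_differentiable differentiable_add differentiable_scaleR derivative_intros)
  qed (simp_all add: zone)
  moreover have "curve r t \<in> H" if t: "t \<in> {0..1}" "t \<notin> arc_interior r" for t
  proof -
    have "norm (curve r t - \<beta> t) \<le> \<sigma> / 8 * (1 / 2)"
      using norm_curve_diff_le[OF t(2)] by (simp add: zone)
    moreover have "\<bar>t - 1 / 2\<bar> \<le> 1"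
      using t(1) by (intro abs_leI) auto
    then have "norm (\<beta> t - z) \<le> 1 * (\<sigma> / 4)"
      unfolding \<beta> using \<sigma>(1) by (simp add: w mult_left_le_one_le)
    ultimately have "norm (curve r t - z) \<le> \<sigma>"
      using norm_triangle_ineq[of "curve r t - \<beta> t" "\<beta> t - z"] \<sigma>(1) by simp
    then show ?thesis
      using \<sigma>(3) by (auto simp: dist_norm norm_minus_commute)
  qed
  moreover have "velocity_near w (\<sigma> / 8) (curve r) {0..arc_lo r}" "velocity_near w (\<sigma> / 8) (curve r) {arc_hi r..1}"
    using velocity_near_left[OF near(2,1)] velocity_near_right[OF near(2,1)] by simp_all
  moreover have "\<sigma> / 8 < norm w"
    using \<sigma>(1) by (simp add: w)
  ultimately show ?thesis
    unfolding root_node_def by blast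
qed

lemma exists_root_node:
  fixes S H :: "'a::euclidean_space set"
  assumes S: "every_portion_pos_cone_width S" "S \<noteq> {}" and H: "open H" "S \<subseteq> closure (S \<inter> H)"
  shows "\<exists>r. root_node S H r"
proof -
  obtain z where z: "z \<in> S" "z \<in> H"
    using S(2) H(2) by (metis Int_iff closure_empty equals0I subset_empty)
  obtain s where s: "0 < s" "cball z s \<subseteq> H"
    using H(1) z(2) open_contains_cball by blast
  define \<sigma> where "\<sigma> = min s 1"
  have \<sigma>: "0 < \<sigma>" "\<sigma> \<le> 1" "cball z \<sigma> \<subseteq> H"
    using s subset_cball[of \<sigma> s z] by (auto simp: \<sigma>_def)
  obtain v :: 'a where v: "norm v = 1"
    using vector_choose_size[of 1] by auto
  define w where "w = (\<sigma> / 4) *\<^sub>R v"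
  have w: "norm w = \<sigma> / 4"
    using v \<sigma>(1) by (simp add: w_def)
  define \<beta> where "\<beta> = (\<lambda>t. z + (t - 1 / 2) *\<^sub>R w)"
  have \<beta>z: "\<beta> (1 / 2) \<in> UNIV" "\<beta> (1 / 2) \<in> S"
    using z(1) by (simp_all add: \<beta>_def)
  have lip: "1-lipschitz_on {1 / 2 - 1 / 4..1 / 2 + 1 / 4} \<beta>"
    unfolding \<beta>_def using \<sigma>(2) w
    by (intro lipschitz_on_le[OF velocity_near_imp_lipschitz[OF velocity_near_linear]]) simp
  have bounds: "tol 0 \<le> 1 / 4" "0 < \<sigma> / 8" "\<sigma> / 8 \<le> 1"
    using \<sigma> by (auto simp: tol_def)
  obtain r where r: "graft (\<sigma> / 8) \<beta> r" "stable_arc S H (tol 0) r" "zone_lo r = 1 / 2 - 1 / 4"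
    "arc_lo r = 1 / 2" "zone_hi r = 1 / 2 + 1 / 4" "norm (velocity r - v) \<le> 2 + tol 0"
    by (rule exists_graft[OF stable_direction_UNIV[OF S v] \<beta>z _ lip H tol_pos bounds]) simp
  have "root_node S H r"
    by (rule root_node_of_graft[OF \<sigma> w \<beta>_def r(1,2)]) (simp_all add: r)
  then show ?thesis ..
qed

lemma exists_admissible_sequence:
  fixes S :: "'a::euclidean_space set"
  assumes S: "every_portion_pos_cone_width S" "S \<noteq> {}"
    and G: "\<And>n. open (G n)" "\<And>n. S \<subseteq> closure (S \<inter> G n)" and B: "\<And>i. open (B i)"
  shows "\<exists>f. \<forall>k. admissible S G B f k (f k)"
proof (rule dependent_wf_choice[OF wf_less_than])
  fix f g :: "nat \<Rightarrow> 'a node" and k r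
  assume "\<And>j. (j, k) \<in> less_than \<Longrightarrow> f j = g j"
  then show "admissible S G B f k r = admissible S G B g k r"
    by (intro admissible_cong) simp
next
  fix k and f :: "nat \<Rightarrow> 'a node"
  assume IH: "\<And>j. (j, k) \<in> less_than \<Longrightarrow> admissible S G B f j (f j)"
  show "\<exists>r. admissible S G B f k r"
  proof (cases k)
    case 0
    then show ?thesis
      using exists_root_node[OF S G] by simp
  next
    case (Suc n)
    then interpret node_prefix S G B f n
      using IH G B by unfold_locales auto
    show ?thesis
      using exists_next_node Suc by simp
  qed
qed

subsection \<open>The limit of a chain\<close>

locale node_chain =
  fixes S :: "'a::euclidean_space set" and G :: "nat \<Rightarrow> 'a set" and B :: "nat \<Rightarrow> real set"
    and f :: "nat \<Rightarrow> 'a node"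
  assumes admissible: "admissible S G B f k (f k)"
    and base: "open U \<Longrightarrow> x \<in> U \<Longrightarrow> \<exists>i. x \<in> B i \<and> B i \<subseteq> U"
    and closed_S: "closed S" and decseq_G: "decseq G"
begin

sublocale node: stable_node S "G k" "tol k" "f k" for k
  by (rule admissible_stable_node[OF admissible])

lemma compatible: "j < k \<Longrightarrow> compatible j (f j) k (f k)"
  by (rule admissible_compatible[OF admissible])

lemma extends: "extends B f n (f (Suc n))"
  using admissible[of "Suc n"] by simp

lemma root: "root_node S (G 0) (f 0)"
  using admissible[of 0] by simp

sublocale local_modifications "\<lambda>n. curve (f n)" "\<lambda>n. zone_lo (f (Suc n))" "\<lambda>n. zone_hi (f (Suc n))" 1 0 1
proof
  fix n t
  show "1-lipschitz_on {0..1} (curve (f n))"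
    by (rule node.lipschitz)
  show "0 \<le> zone_lo (f (Suc n))" "zone_lo (f (Suc n)) \<le> zone_hi (f (Suc n))" "zone_hi (f (Suc n)) \<le> 1"
    using node.zone_bounds node.zone_less by (auto intro: less_imp_le)
  show "zone_hi (f (Suc n)) - zone_lo (f (Suc n)) \<le> (1 / 8) ^ n"
    using extends[of n] by (simp add: extends_def)
  show "curve (f (Suc n)) t = curve (f n) t" if "t \<notin> {zone_lo (f (Suc n))<..<zone_hi (f (Suc n))}"
    using that extends[of n] by (simp add: extends_def)
qed

lemma limit_eq_curve:
  assumes "\<And>j. k < j \<Longrightarrow> t \<notin> {zone_lo (f j)<..<zone_hi (f j)}"
  shows "limit t = curve (f k) t"
  using assms by (intro limit_eq) auto

lemma AE_differentiable: "AE t in lebesgue. t \<in> {0<..<1} \<longrightarrow> limit differentiable (at t)"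
  by (intro AE_limit_differentiable node.piecewise_differentiable)

lemma velocity_near_limit_arc: "velocity_near (velocity (f k)) (8 * tol k) limit (arc_times (f k))"
proof (rule velocity_near_limit_curve)
  fix n assume "Suc k \<le> n"
  then show "velocity_near (velocity (f k)) (8 * tol k) (curve (f n)) (arc_times (f k))"
    using compatible[of k n] by (simp add: compatible_def)
qed

lemma limit_arc_lo: "limit (arc_lo (f k)) = curve (f k) (arc_lo (f k))"
proof (rule limit_eq_curve)
  fix j assume "k < j"
  then have "zone (f j) \<inter> zone (f k) = {} \<or> zone (f j) \<subseteq> arc_interior (f k)"
    using compatible by (auto simp: compatible_def)
  moreover have "arc_lo (f k) \<in> zone (f k)" "arc_lo (f k) \<notin> arc_interior (f k)"
    using node.zone_bounds[of k] node.arc_pos[of k] by auto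
  ultimately have "arc_lo (f k) \<notin> zone (f j)" by blast
  then show "arc_lo (f k) \<notin> {zone_lo (f j)<..<zone_hi (f j)}" by auto
qed

lemma dist_limit_arc_lo_le:
  assumes "t \<in> arc_times (f k)"
  shows "dist (curve (f k) (arc_lo (f k))) (limit t) \<le> arc_hi (f k) - arc_lo (f k)"
proof -
  have "arc_lo (f k) \<in> arc_times (f k)"
    using node.arc_pos[of k] by simp
  then have "dist (limit (arc_lo (f k))) (limit t) \<le> 1 * dist (arc_lo (f k)) t"
    using assms node.arc_times_subset_zone node.zone_subset by (intro lipschitz_onD[OF lipschitz_on_limit]) blast+
  then show ?thesis
    using assms by (auto simp: limit_arc_lo dist_real_def)
qed

lemma limit_arc_in_G: "t \<in> arc_times (f k) \<Longrightarrow> limit t \<in> G k"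
  using dist_limit_arc_lo_le node.cball_subset by fastforce

lemma limit_arc_near_S:
  assumes "t \<in> arc_times (f k)"
  shows "\<exists>y\<in>S. dist y (limit t) \<le> 2 * tol k"
proof -
  obtain c where c: "c \<in> arc_times (f k)" "curve (f k) c \<in> S"
    by (rule node.core_point)
  have "dist (curve (f k) c) (curve (f k) (arc_lo (f k))) \<le> arc_hi (f k) - arc_lo (f k)"
    using c(1) node.arc_pos[of k] by (intro node.dist_curve_le) auto
  then have "dist (curve (f k) c) (limit t) \<le> 2 * tol k"
    using dist_limit_arc_lo_le[OF assms] node.arc_length[of k]
      dist_triangle[of "curve (f k) c" "limit t" "curve (f k) (arc_lo (f k))"] by simp
  then show ?thesis
    using c(2) by blast
qed

lemma limit_eq_root:
  assumes "t \<notin> arc_interior (f 0)"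
  shows "limit t = curve (f 0) t"
proof (rule limit_eq_curve)
  fix j :: nat assume "0 < j"
  then have "zone (f j) \<subseteq> arc_interior (f 0)"
  proof (induction j rule: less_induct)
    case (less j)
    then obtain n where n: "j = Suc n"
      using gr0_implies_Suc by blast
    obtain p i where pi: "prod_decode n = (p, i)" by force
    then have p: "p < j" "zone (f j) \<subseteq> arc_interior (f p)"
      using extends[of n] prod_decode_fst_le[OF pi] n by (auto simp: extends_def)
    show ?case
    proof (cases "p = 0")
      case False
      then show ?thesis
        using less.IH[OF p(1)] p(2) node.arc_interior_subset_zone[of p] by blast
    qed (use p(2) in simp)
  qed
  then have "t \<notin> zone (f j)"
    using assms by blast
  then show "t \<notin> {zone_lo (f j)<..<zone_hi (f j)}" by auto
qed

lemma limit_in_G0: "limit ` {0..1} \<subseteq> G 0"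
proof safe
  fix t :: real assume t: "t \<in> {0..1}"
  show "limit t \<in> G 0"
  proof (cases "t \<in> arc_interior (f 0)")
    case True
    then show ?thesis
      using limit_arc_in_G arc_interior_subset_times by blast
  next
    case False
    then show ?thesis
      using root t limit_eq_root by (auto simp: root_node_def image_subset_iff)
  qed
qed

lemma lipschitz_curve_limit: "lipschitz_curve 0 1 limit"
proof -
  let ?l = "arc_lo (f 0)" and ?h = "arc_hi (f 0)"
  obtain w e where e: "e < norm w"
    and w: "velocity_near w e (curve (f 0)) {0..?l}" "velocity_near w e (curve (f 0)) {?h..1}"
    using root by (auto simp: root_node_def)
  have near: "velocity_near w e limit {0..?l}" "velocity_near w e limit {?h..1}"
    using w velocity_near_cong[of "{0..?l}" limit "curve (f 0)" w e]
      velocity_near_cong[of "{?h..1}" limit "curve (f 0)" w e] limit_eq_root by simp_all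
  show ?thesis
  proof (rule lipschitz_curveI[OF _ lipschitz_on_limit _ _ AE_differentiable])
    show "0 < min (norm w - e) (3 / 4)"
      using e by simp
    show "finite {?l, ?h}"
      by simp
    fix t assume "t \<in> {0<..<1} - {?l, ?h}"
    then consider "t \<in> {0<..<?l}" | "t \<in> arc_interior (f 0)" | "t \<in> {?h<..<1}"
      by fastforce
    then show "\<exists>w' e'. locally_velocity_near w' e' limit t \<and> e' + min (norm w - e) (3 / 4) \<le> norm w'"
    proof cases
      case 2
      have "locally_velocity_near (velocity (f 0)) (8 * tol 0) limit t"
        by (rule locally_velocity_nearI[OF velocity_near_limit_arc 2])
      then show ?thesis
        using node.norm_velocity[of 0] by (intro exI conjI) (auto simp: tol_def)
    qed (use near in \<open>auto dest!: locally_velocity_nearI intro!: exI[of _ w] exI[of _ e]\<close>)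
  qed simp
qed

definition deep_times :: "real set" where
  "deep_times = (\<Inter>n. \<Union>k\<in>{n..}. arc_interior (f k))"

lemma deep_timesE:
  assumes "t \<in> deep_times" "0 < e"
  obtains k where "n \<le> k" "t \<in> arc_interior (f k)" "tol k < e"
proof -
  obtain m where m: "\<forall>k\<ge>m. tol k < e"
    using exists_tol_less[OF assms(2)] by blast
  obtain k where k: "k \<in> {max n m..}" "t \<in> arc_interior (f k)"
    using assms(1) unfolding deep_times_def by blast
  then show thesis
    using m by (intro that[OF _ k(2)]) auto
qed

lemma limit_deep_times_in_S:
  assumes t: "t \<in> deep_times"
  shows "limit t \<in> S"
proof -
  have "\<exists>y\<in>S. dist y (limit t) < e" if e: "0 < e" for e
  proof -
    obtain k where k: "t \<in> arc_interior (f k)" "tol k < e / 2"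
      using deep_timesE[OF t half_gt_zero[OF e]] .
    then obtain y where "y \<in> S" "dist y (limit t) \<le> 2 * tol k"
      using limit_arc_near_S arc_interior_subset_times by blast
    then show ?thesis
      using k(2) by force
  qed
  then show ?thesis
    using closed_S by (metis closed_approachable)
qed

lemma limit_deep_times_in_G:
  assumes "t \<in> deep_times"
  shows "limit t \<in> G n"
proof -
  obtain k where k: "n \<le> k" "t \<in> arc_interior (f k)"
    using deep_timesE[OF assms zero_less_one] .
  then have "limit t \<in> G k"
    using limit_arc_in_G arc_interior_subset_times by blast
  then show ?thesis
    using decseq_G k(1) by (auto simp: decseq_def)
qed

lemma deep_times_locally_velocity_near:
  assumes "t \<in> deep_times" "0 < e"
  shows "\<exists>w\<in>sphere 0 1. locally_velocity_near w e limit t"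
proof -
  obtain k where "t \<in> arc_interior (f k)" "tol k < e / 8"
    using deep_timesE[OF assms(1), of "e / 8"] assms(2) by auto
  then have "locally_velocity_near (velocity (f k)) e limit t"
    by (intro locally_velocity_nearI[of _ _ _ "arc_lo (f k)" "arc_hi (f k)"]
        velocity_near_mono[OF velocity_near_limit_arc order_refl]) auto
  then show ?thesis
    using node.norm_velocity by auto
qed

lemma limit_has_unit_derivative:
  assumes "t \<in> deep_times"
  shows "\<exists>v. (limit has_vector_derivative v) (at t within {0..1}) \<and> norm v = 1"
  using exists_vector_derivative_of_locally_velocity_near[OF deep_times_locally_velocity_near[OF assms] closed_sphere]
    has_vector_derivative_at_within by fastforce

lemma osc_derivative_tendsto_0:
  assumes "t \<in> deep_times"
  shows "((\<lambda>\<delta>. osc (\<lambda>s. vector_derivative limit (at s within {0..1})) ({t-\<delta>..t+\<delta>} \<inter> {0..1})) \<longlongrightarrow> 0) (at_right 0)"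
proof (rule osc_vector_derivative_tendsto_0[OF _ _ AE_differentiable])
  show "\<exists>w. locally_velocity_near w e limit t" if "0 < e" for e
    using deep_times_locally_velocity_near[OF assms that] by blast
  obtain k where "t \<in> arc_interior (f k)"
    using deep_timesE[OF assms zero_less_one] .
  then show "t \<in> {0<..<1}"
    using node.zone_bounds[of k] by auto
qed

definition residue :: "nat \<Rightarrow> real set" where
  "residue p = untouched f p {p<..}"

lemma residue_subset: "residue p \<subseteq> arc_interior (f p)"
  using node.core_subset by (auto simp: residue_def untouched_def)

lemma sets_residue: "residue p \<in> sets lebesgue"
  unfolding residue_def untouched_def
  using node.core_compact by (intro sets.Diff sets.countable_UN') (auto intro: fmeasurableD lmeasurable_compact)

lemma emeasure_residue_pos: "0 < emeasure lebesgue (residue p)"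
  unfolding residue_def
  by (rule emeasure_untouched_pos[OF node.stable_node_axioms]) (auto intro: less_imp_le node.zone_less compatible)

lemma residue_in_open_set:
  assumes "open U" "x \<in> U" "x \<in> residue p"
  shows "\<exists>q>p. residue q \<subseteq> U"
proof -
  obtain i where i: "x \<in> B i" "B i \<subseteq> U"
    using base[OF assms(1,2)] by blast
  define n where "n = prod_encode (p, i)"
  then have "p \<le> n"
    by (simp add: le_prod_encode_1)
  have "x \<in> untouched f p {p<..n} \<inter> B i"
    using assms(3) i(1) by (auto simp: residue_def untouched_def)
  then have "zone (f (Suc n)) \<subseteq> B i"
    using extends[of n] by (auto simp: extends_def n_def)
  then have "residue (Suc n) \<subseteq> U"
    using residue_subset node.arc_interior_subset_zone i(2) by blast
  then show ?thesis
    using \<open>p \<le> n\<close> less_Suc_eq_le by blast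
qed

lemma residue_in_open_set_late:
  assumes U: "open U" "U \<inter> residue p \<noteq> {}"
  shows "\<exists>q\<ge>n. residue q \<subseteq> U"
proof (induction n)
  case 0
  obtain x where "x \<in> U" "x \<in> residue p"
    using U(2) by blast
  then show ?case
    using residue_in_open_set[OF U(1)] by blast
next
  case (Suc n)
  then obtain q where "n \<le> q" "residue q \<subseteq> U" by blast
  moreover have "residue q \<noteq> {}"
    using emeasure_residue_pos[of q] by force
  ultimately obtain q' where "q < q'" "residue q' \<subseteq> U"
    using residue_in_open_set[OF U(1)] by blast
  then show ?case
    using \<open>n \<le> q\<close> by (intro exI[of _ q']) simp
qed

definition support_times :: "real set" where
  "support_times = lebesgue_support (\<Union>p. residue p)"

lemma sets_Union_residue: "(\<Union>p. residue p) \<in> sets lebesgue"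
  using sets_residue by blast

lemma closed_support_times: "closed support_times"
  unfolding support_times_def by (rule closed_lebesgue_support)

lemma every_portion_pos_measure_support_times: "every_portion_pos_measure support_times"
  unfolding support_times_def by (rule every_portion_pos_measure_lebesgue_support[OF sets_Union_residue])

lemma residue_meets_support_times: "residue p \<inter> support_times \<noteq> {}"
  unfolding support_times_def by (rule lebesgue_support_meets[OF emeasure_residue_pos sets_Union_residue]) blast

lemma support_times_nonempty: "support_times \<noteq> {}"
  using residue_meets_support_times by blast

lemma support_times_subset: "support_times \<subseteq> {0..1}"
proof -
  have "(\<Union>p. residue p) \<subseteq> {0..1}"
    using residue_subset node.arc_interior_subset_zone node.zone_subset by blast
  then have "closure (\<Union>p. residue p) \<subseteq> {0..1}"
    by (rule closure_minimal) simp
  then show ?thesis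
    unfolding support_times_def using lebesgue_support_subset_closure by (rule order_trans[rotated])
qed

lemma support_times_subset_closure_late_arcs:
  "support_times \<subseteq> closure (support_times \<inter> (\<Union>k\<in>{n..}. arc_interior (f k)))"
  (is "support_times \<subseteq> closure ?X")
proof (rule ccontr)
  assume "\<not> support_times \<subseteq> closure ?X"
  then obtain t where "t \<in> support_times" "t \<in> - closure ?X" by blast
  then have "0 < emeasure lebesgue (- closure ?X \<inter> (\<Union>p. residue p))"
    unfolding support_times_def lebesgue_support_def by (auto simp: open_Compl)
  then have "- closure ?X \<inter> (\<Union>p. residue p) \<noteq> {}"
    by force
  then obtain p where "- closure ?X \<inter> residue p \<noteq> {}" by blast
  from residue_in_open_set_late[OF _ this, of n] obtain q where q: "n \<le> q" "residue q \<subseteq> - closure ?X"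
    by (auto simp: open_Compl)
  obtain s where "s \<in> residue q" "s \<in> support_times"
    using residue_meets_support_times by blast
  then have "s \<in> ?X"
    using residue_subset q(1) by blast
  then show False
    using q(2) \<open>s \<in> residue q\<close> closure_subset[of ?X] by blast
qed

lemma residual_in_deep_times: "residual_in support_times (support_times \<inter> deep_times)"
  unfolding deep_times_def by (intro residual_in_Int_INT_open support_times_subset_closure_late_arcs open_UN) simp

end

lemma exists_node_chain:
  fixes S :: "'a::euclidean_space set"
  assumes "every_portion_pos_cone_width S" "S \<noteq> {}" "closed S"
    and "\<And>n. open (G n)" "\<And>n. S \<subseteq> closure (S \<inter> G n)" "decseq G"
  shows "\<exists>B f. node_chain S G B f"
proof -
  obtain B :: "nat \<Rightarrow> real set" where "inj B"
    and B: "\<And>i. open (B i)" "\<And>U. open U \<Longrightarrow> \<exists>I. U = \<Union>{B i |i. i \<in> I}"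
    by (rule univ_second_countable_sequence) (rule that)
  have "\<exists>f. \<forall>k. admissible S G B f k (f k)"
    by (rule exists_admissible_sequence) (rule assms B(1))+
  then obtain f where "\<And>k. admissible S G B f k (f k)" by blast
  moreover have "\<exists>i. x \<in> B i \<and> B i \<subseteq> U" if "open U" "x \<in> U" for U x
    using B(2)[OF that(1)] that(2) by blast
  ultimately have "node_chain S G B f"
    using assms(3,6) by unfold_locales
  then show ?thesis by blast
qed

theorem theorem2p11:
  fixes \<F> \<A> :: "'a::euclidean_space set"
  assumes "\<F> \<subseteq> cbox 0 One" and "\<F> \<noteq> {}" and "closed \<F>"
    and "every_portion_pos_cone_width \<F>"
    and "\<A> \<subseteq> box 0 One" and "analytic_set \<A>"
    and "residual_in \<F> (\<A> \<inter> \<F>)"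
  shows "\<exists>(\<gamma>::real \<Rightarrow> 'a) E F.
           lipschitz_curve 0 1 \<gamma> \<and> 1-lipschitz_on {0..1} \<gamma> \<and> \<gamma> ` {0..1} \<subseteq> box 0 One
         \<and> E \<subseteq> F \<and> F \<subseteq> {0..1}
         \<and> F \<noteq> {} \<and> closed F \<and> every_portion_pos_measure F
         \<and> residual_in F E
         \<and> (\<forall>t\<in>E. \<exists>v. (\<gamma> has_vector_derivative v) (at t within {0..1}) \<and> norm v = 1)
         \<and> (\<forall>t\<in>E. ((\<lambda>\<delta>. osc (\<lambda>s. vector_derivative \<gamma> (at s within {0..1}))
                              ({t-\<delta>..t+\<delta>} \<inter> {0..1})) \<longlongrightarrow> 0) (at_right 0))
         \<and> \<gamma> ` E \<subseteq> \<A>"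
proof -
  obtain G :: "nat \<Rightarrow> 'a set" where G: "\<And>n. open (G n)" "decseq G" "\<And>n. G n \<subseteq> box 0 One"
    "\<And>n. \<F> \<subseteq> closure (\<F> \<inter> G n)" "\<F> \<inter> (\<Inter>n. G n) \<subseteq> \<A>"
    using residual_inE[OF assms(7,3) open_box assms(5)] by blast
  obtain B f where "node_chain \<F> G B f"
    using exists_node_chain[OF assms(4,2,3) G(1,4,2)] by blast
  then interpret node_chain \<F> G B f .
  have "limit ` {0..1} \<subseteq> box 0 One"
    using limit_in_G0 G(3) by blast
  moreover have "limit ` (support_times \<inter> deep_times) \<subseteq> \<A>"
    using limit_deep_times_in_S limit_deep_times_in_G G(5) by blast
  ultimately show ?thesis
    using lipschitz_curve_limit lipschitz_on_limit support_times_subset support_times_nonempty closed_support_times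
      every_portion_pos_measure_support_times residual_in_deep_times limit_has_unit_derivative osc_derivative_tendsto_0
    by (intro exI[of _ limit] exI[of _ "support_times \<inter> deep_times"] exI[of _ support_times] conjI ballI) auto
qed

end
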